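(* Let $T>0$, $d\ge 1$, and let $\mu=\{\mu_t\}_{0\le t\le T}$ be a continuous family of Borel probability measures on $\mathbb{R}^d$ with densities $p(t,x)=d\mu_t/dx$. Let $K:\mathbb{R}^{d+1}\to\mathbb{R}$ define the translation-invariant kernel $K(\xi,\eta)=K(\xi-\eta)$ with RKHS $\mathcal{H}$ and norm $\|\cdot\|$. Suppose: (A1) $K\in C(\mathbb{R}^{d+1})\cap L^1(\mathbb{R}^{d+1})$ is positive definite and $\mathcal{H}$ is universal on every compact subset of $[0,T]\times\mathbb{R}^d$, understood in the sense that $\mathrm{supp}\,\widehat K=\mathbb{R}^{d+1}$; (A2) $\int_{\mathbb{R}^{d+1}}(1+|z|^2)\widehat K(z)\,dz<\infty$; (A3) $p\in C([0,T];L^1(\mathbb{R}^d))\cap L^\infty([0,T]\times\mathbb{R}^d)$, each $p(t,\cdot)$ is a probability density on $\mathbb{R}^d$, and $\partial_tp\in L^1((0,T)\times\mathbb{R}^d)$ in the weak sense. Let $(X_t)_{0\le t\le T}$ and $(\tilde X_t)_{0\le t\le T}$ be independent continuous $\mathbb{R}^d$-valued processes such that $X_t\sim\mu_t$ and $\tilde X_t\sim\mu_t$ for every $t\in[0,T]$, and let $u\in L^1([0,T]\times\mathbb{R}^d;\mathbb{R}^d,p(t,x)\,dt\,dx)$. Then for every $t\in[0,T]$, $$\|H_t^u\|^2=I_1(t)+I_2(t)+I_3(t)-2I_4(t)-2I_5(t)+2I_6(t),$$ where $$I_1(t)=\int_0^t\int_0^t\mathbb{E}\bigl[\mathcal{A}^u_s\mathcal{A}^u_rK(s,X_s,r,\tilde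 X_r)\bigr]\,ds\,dr,\qquad I_2(t)=\mathbb{E}\bigl[K(t,X_t,t,\tilde X_t)\bigr],$$ $$I_3(t)=\mathbb{E}\bigl[K(0,X_0,0,\tilde X_0)\bigr],\qquad I_4(t)=\int_0^t\mathbb{E}\bigl[\mathcal{A}^u_sK(t,X_t,s,\tilde X_s)\bigr]\,ds,$$ $$I_5(t)=\mathbb{E}\bigl[K(0,X_0,t,\tilde X_t)\bigr],\qquad I_6(t)=\int_0^t\mathbb{E}\bigl[\mathcal{A}^u_sK(0,X_0,s,\tilde X_s)\bigr]\,ds .$$
   Context: Fourier transform: $\widehat K(z)=(2\pi)^{-(d+1)/2}\int_{\mathbb{R}^{d+1}}e^{-iz^{\mathsf T}\xi}K(\xi)\,d\xi$; under (A1), $\widehat K\ge0$. $\mathcal{H}$ is the real RKHS of functions on $\mathbb{R}^{d+1}$ (points written $(t,x)$, $t\in\mathbb{R}$, $x\in\mathbb{R}^d$) with reproducing kernel $K(t,x,s,y)=K((t,x)-(s,y))$. $L^q(A;\mathbb{R}^m,\nu)$ is the space of Borel functions $f:A\to\mathbb{R}^m$ with $\int_A|f|^q\,d\nu<\infty$. Operator: $\mathcal{A}^u\varphi=\partial_t\varphi+u^{\mathsf T}\nabla_x\varphi$; $\mathcal{A}^u_{r,y}$ means that $\mathcal{A}^u$ acts on the variable $(r,y)$ (with coefficient $u(r,y)$). In the expectations, the operators are applied first and the random points substituted afterwards: $\mathcal{A}^u_s\mathcal{A}^u_rK(s,X_s,r,\tilde X_r)=\bigl[\mathcal{A}^u_{s,x}\mathcal{A}^u_{r,y}K(s,x,r,y)\bigr]_{x=X_s,\,y=\tilde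 X_r}$, and $\mathcal{A}^u_sK(t,X_t,s,\tilde X_s)=\bigl[\mathcal{A}^u_{s,y}K(t,x,s,y)\bigr]_{x=X_t,\,y=\tilde X_s}$ (the operator acts on the second space-time argument), and similarly $\mathcal{A}^u_sK(0,X_0,s,\tilde X_s)=\bigl[\mathcal{A}^u_{s,y}K(0,x,s,y)\bigr]_{x=X_0,\,y=\tilde X_s}$. For $u\in L^1([0,T]\times\mathbb{R}^d;\mathbb{R}^d,p\,dt\,dx)$ and $s\in[0,T]$, the function $$H_s^u(t,x):=\int_0^s\int_{\mathbb{R}^d}p(r,y)\,\mathcal{A}^u_{r,y}K(t,x,r,y)\,dy\,dr-\int_{\mathbb{R}^d}p(s,y)K(t,x,s,y)\,dy+\int_{\mathbb{R}^d}p(0,y)K(t,x,0,y)\,dy$$ is an element of $\mathcal{H}$ under (A1)--(A3). *)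

theory Defs
  imports "HOL-Probability.Probability"
begin

section \<open>Positive definite functions and reproducing kernel Hilbert spaces\<close>

text \<open>
  Symmetry is part of the definition, since for real coefficients it does not follow from
  the nonnegativity of the quadratic forms.
\<close>

definition positive_definite_fun :: "('a::real_vector \<Rightarrow> real) \<Rightarrow> bool" where
  "positive_definite_fun K \<longleftrightarrow>
     (\<forall>\<xi>. K (- \<xi>) = K \<xi>) \<and>
     (\<forall>S c. finite S \<longrightarrow> 0 \<le> (\<Sum>\<xi>\<in>S. \<Sum>\<eta>\<in>S. c \<xi> * c \<eta> * K (\<xi> - \<eta>)))"

definition translation_kernel :: "('a::real_vector \<Rightarrow> real) \<Rightarrow> 'a \<Rightarrow> 'a \<Rightarrow> real" where
  "translation_kernel K \<xi> \<eta> = K (\<xi> - \<eta>)"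

definition rkhs_norm :: "(('a \<Rightarrow> real) \<Rightarrow> ('a \<Rightarrow> real) \<Rightarrow> real) \<Rightarrow> ('a \<Rightarrow> real) \<Rightarrow> real" where
  "rkhs_norm ip f = sqrt (ip f f)"

text \<open>
  \<open>rkhs H ip k\<close>: the set \<open>H\<close> of real functions with inner product \<open>ip\<close> is a real Hilbert space
  with reproducing kernel \<open>k\<close>. By the Moore--Aronszajn theorem, \<open>H\<close> and the values of \<open>ip\<close>
  on \<open>H\<close> are determined by \<open>k\<close>; the values of \<open>ip\<close> outside \<open>H\<close> are unconstrained.
\<close>

locale rkhs =
  fixes H :: "('a \<Rightarrow> real) set"
    and ip :: "('a \<Rightarrow> real) \<Rightarrow> ('a \<Rightarrow> real) \<Rightarrow> real"
    and k :: "'a \<Rightarrow> 'a \<Rightarrow> real"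
  assumes zero_mem: "(\<lambda>\<xi>. 0) \<in> H"
    and add_mem: "\<lbrakk>f \<in> H; g \<in> H\<rbrakk> \<Longrightarrow> (\<lambda>\<xi>. f \<xi> + g \<xi>) \<in> H"
    and scale_mem: "f \<in> H \<Longrightarrow> (\<lambda>\<xi>. c * f \<xi>) \<in> H"
    and ip_sym: "\<lbrakk>f \<in> H; g \<in> H\<rbrakk> \<Longrightarrow> ip f g = ip g f"
    and ip_add: "\<lbrakk>f \<in> H; g \<in> H; h \<in> H\<rbrakk> \<Longrightarrow> ip (\<lambda>\<xi>. f \<xi> + g \<xi>) h = ip f h + ip g h"
    and ip_scale: "\<lbrakk>f \<in> H; g \<in> H\<rbrakk> \<Longrightarrow> ip (\<lambda>\<xi>. c * f \<xi>) g = c * ip f g"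
    and ip_nonneg: "f \<in> H \<Longrightarrow> 0 \<le> ip f f"
    and ip_definite: "\<lbrakk>f \<in> H; ip f f = 0\<rbrakk> \<Longrightarrow> f = (\<lambda>\<xi>. 0)"
    and complete:
      "\<And>F :: nat \<Rightarrow> 'a \<Rightarrow> real. \<lbrakk>\<And>n. F n \<in> H;
         \<And>e. 0 < e \<Longrightarrow> \<exists>N. \<forall>m\<ge>N. \<forall>n\<ge>N. rkhs_norm ip (\<lambda>\<xi>. F m \<xi> - F n \<xi>) < e\<rbrakk>
       \<Longrightarrow> \<exists>g\<in>H. (\<lambda>n. rkhs_norm ip (\<lambda>\<xi>. F n \<xi> - g \<xi>)) \<longlonglongrightarrow> 0"
    and kernel_mem: "(\<lambda>\<xi>. k \<xi> \<eta>) \<in> H"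
    and reproducing: "f \<in> H \<Longrightarrow> ip f (\<lambda>\<xi>. k \<xi> \<eta>) = f \<eta>"

section \<open>Fourier transform\<close>

definition fourier_transform :: "('a::euclidean_space \<Rightarrow> real) \<Rightarrow> 'a \<Rightarrow> complex" where
  "fourier_transform f z =
     complex_of_real ((2 * pi) powr (- (real DIM('a) / 2))) *
     (LINT \<xi>|lborel. exp (- (\<i> * complex_of_real (z \<bullet> \<xi>))) * complex_of_real (f \<xi>))"

definition fun_support :: "('a::topological_space \<Rightarrow> 'b::zero) \<Rightarrow> 'a set" where
  "fun_support f = closure {z. f z \<noteq> 0}"

section \<open>The transport operator\<close>

definition time_deriv :: "(real \<times> (real ^ 'n) \<Rightarrow> real) \<Rightarrow> real \<times> (real ^ 'n) \<Rightarrow> real" where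
  "time_deriv \<phi> z = deriv (\<lambda>\<tau>. \<phi> (\<tau>, snd z)) (fst z)"

definition space_grad :: "(real \<times> (real ^ 'n) \<Rightarrow> real) \<Rightarrow> real \<times> (real ^ 'n) \<Rightarrow> real ^ 'n" where
  "space_grad \<phi> z = (\<chi> i. deriv (\<lambda>h. \<phi> (fst z, snd z + h *\<^sub>R axis i 1)) 0)"

definition transport_op ::
    "(real \<times> (real ^ 'n) \<Rightarrow> real ^ 'n) \<Rightarrow> (real \<times> (real ^ 'n) \<Rightarrow> real) \<Rightarrow> real \<times> (real ^ 'n) \<Rightarrow> real"
  where "transport_op u \<phi> z = time_deriv \<phi> z + u z \<bullet> space_grad \<phi> z"

definition transport_snd ::
    "(real \<times> (real ^ 'n) \<Rightarrow> real ^ 'n) \<Rightarrow> (real \<times> (real ^ 'n) \<Rightarrow> real \<times> (real ^ 'n) \<Rightarrow> real)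
      \<Rightarrow> real \<times> (real ^ 'n) \<Rightarrow> real \<times> (real ^ 'n) \<Rightarrow> real"
  where "transport_snd u k \<xi> \<eta> = transport_op u (\<lambda>\<eta>'. k \<xi> \<eta>') \<eta>"

definition transport_fst ::
    "(real \<times> (real ^ 'n) \<Rightarrow> real ^ 'n) \<Rightarrow> (real \<times> (real ^ 'n) \<Rightarrow> real \<times> (real ^ 'n) \<Rightarrow> real)
      \<Rightarrow> real \<times> (real ^ 'n) \<Rightarrow> real \<times> (real ^ 'n) \<Rightarrow> real"
  where "transport_fst u k \<xi> \<eta> = transport_op u (\<lambda>\<xi>'. k \<xi>' \<eta>) \<xi>"

definition transport_residual ::
    "(real \<times> (real ^ 'n) \<Rightarrow> real) \<Rightarrow> (real \<times> (real ^ 'n) \<Rightarrow> real)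
      \<Rightarrow> (real \<times> (real ^ 'n) \<Rightarrow> real ^ 'n) \<Rightarrow> real \<Rightarrow> real \<times> (real ^ 'n) \<Rightarrow> real" where
  "transport_residual K p u s \<xi> =
     (LINT r:{0..s}|lborel. LINT y|lborel.
        p (r, y) * transport_snd u (translation_kernel K) \<xi> (r, y))
     - (LINT y|lborel. p (s, y) * translation_kernel K \<xi> (s, y))
     + (LINT y|lborel. p (0, y) * translation_kernel K \<xi> (0, y))"

section \<open>Regularity of the density\<close>

primrec Ck_fun :: "nat \<Rightarrow> ('a::real_normed_vector \<Rightarrow> real) \<Rightarrow> bool" where
  "Ck_fun 0 f \<longleftrightarrow> continuous_on UNIV f"
| "Ck_fun (Suc k) f \<longleftrightarrow>
     f differentiable_on UNIV \<and> (\<forall>v. Ck_fun k (\<lambda>x. frechet_derivative f (at x) v))"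

definition test_function :: "('a::real_normed_vector) set \<Rightarrow> ('a \<Rightarrow> real) \<Rightarrow> bool" where
  "test_function \<Omega> \<phi> \<longleftrightarrow>
     (\<forall>k. Ck_fun k \<phi>) \<and> compact (fun_support \<phi>) \<and> fun_support \<phi> \<subseteq> \<Omega>"

definition weak_time_deriv_on ::
    "(real \<times> (real ^ 'n)) set \<Rightarrow> (real \<times> (real ^ 'n) \<Rightarrow> real) \<Rightarrow> (real \<times> (real ^ 'n) \<Rightarrow> real) \<Rightarrow> bool"
  where "weak_time_deriv_on \<Omega> p g \<longleftrightarrow>
     (\<forall>\<phi>. test_function \<Omega> \<phi> \<longrightarrow>
        (LINT z:\<Omega>|lborel. p z * time_deriv \<phi> z) = - (LINT z:\<Omega>|lborel. g z * \<phi> z))"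

definition L1_continuous_on :: "real set \<Rightarrow> (real \<times> (real ^ 'n) \<Rightarrow> real) \<Rightarrow> bool" where
  "L1_continuous_on A p \<longleftrightarrow>
     (\<forall>t\<in>A. integrable lborel (\<lambda>x. p (t, x))) \<and>
     (\<forall>t\<in>A. ((\<lambda>s. LINT x|lborel. \<bar>p (s, x) - p (t, x)\<bar>) \<longlongrightarrow> 0) (at t within A))"

definition narrowly_continuous_on :: "real set \<Rightarrow> (real \<Rightarrow> (real ^ 'n) measure) \<Rightarrow> bool" where
  "narrowly_continuous_on A \<mu> \<longleftrightarrow>
     (\<forall>f :: real ^ 'n \<Rightarrow> real. continuous_on UNIV f \<and> bounded (range f) \<longrightarrow>
        continuous_on A (\<lambda>t. LINT x|\<mu> t. f x))"

end

theory Submission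
  imports Defs
begin

text \<open>
  Fourier inversion writes \<open>K\<close> as a cosine transform of a function with finite second moment, so \<open>K\<close> has
  bounded derivatives up to order two. Hence a functional \<open>L f = \<integral> (a f + \<nabla>f \<bullet> w) dm\<close> with integrable \<open>a\<close>
  and \<open>w\<close> is bounded on the differentiable elements of the RKHS. Its Riesz representer is
  \<open>\<xi> \<mapsto> L (k \<xi>)\<close>, and differentiating this once more under the integral shows that it may itself be inserted
  into any other such functional. The residual is a signed sum of three representers, one for the
  space-time measure \<open>p dt dx\<close> with \<open>w = (1, u)\<close> and one for each of \<open>\<mu>\<^sub>t\<close> and \<open>\<mu>\<^sub>0\<close> with \<open>a = 1\<close>; expanding the
  square gives the six double integrals, which independence turns into expectations.
\<close>

section \<open>Fourier inversion\<close>

text \<open>The space \<open>H\<close> is known only through \<open>ip\<close> and evaluation, so no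
  vector-valued integral is formed: the pieces of the residual enter \<open>H\<close> as Riesz
  representers and are identified by pairing them with kernel sections. A functional involving
  gradients must then be controlled by the RKHS norm alone. The lever is the squared distance
  \<open>2 * K 0 - 2 * K x\<close> between kernel sections at two points that differ by
  \<open>x\<close>. Taylor's formula makes it quadratic in \<open>x\<close>, which gives every
  element of \<open>H\<close> a Lipschitz constant, and this constant bounds any gradient that the
  element has. Differentiability is not derived for all of \<open>H\<close>, hence the functionals
  live on a subspace that need not be closed.

  Two features of the data shape the rest. \<open>p\<close> and \<open>u\<close> are Borel only on
  the strip over \<open>[0, T]\<close>, and \<open>p\<close> is nonnegative only almost everywhere
  in each slice, so global Borel replacements \<open>\<rho>\<close> and \<open>w\<close> are used.
  And \<open>u\<close> is merely integrable in space-time, so slice integrals involving it are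
  guaranteed to exist only for almost every time; integrands are dominated by products such as
  \<open>norm (w x) * (C * norm (w y))\<close>.\<close>

lemma lborel_integral_affine:
  fixes f :: "'a::euclidean_space \<Rightarrow> 'b::{banach, second_countable_topology}"
  assumes [measurable]: "f \<in> borel_measurable borel" and c: "c \<noteq> 0"
  shows "(LINT x|lborel. f x) = \<bar>c\<bar> ^ DIM('a) *\<^sub>R (LINT x|lborel. f (t + c *\<^sub>R x))"
proof -
  have "(LINT x|lborel. f x) =
      (LINT x|density (distr lborel borel (\<lambda>x. t + c *\<^sub>R x)) (\<lambda>_. ennreal (\<bar>c\<bar> ^ DIM('a))). f x)"
    using lborel_affine[OF c, of t] by (simp add: ennreal_power)
  also have "\<dots> = (LINT x|distr lborel borel (\<lambda>x. t + c *\<^sub>R x). \<bar>c\<bar> ^ DIM('a) *\<^sub>R f x)"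
    by (rule integral_density) auto
  also have "\<dots> = (LINT x|lborel. \<bar>c\<bar> ^ DIM('a) *\<^sub>R f (t + c *\<^sub>R x))"
    by (rule integral_distr) auto
  finally show ?thesis by simp
qed

text \<open>Supplies the integrable majorants of product form on which the later Fubini steps
  rest.\<close>

lemma integrable_pair_mult:
  fixes f :: "'a \<Rightarrow> real" and g :: "'b \<Rightarrow> real"
  assumes M: "sigma_finite_measure M" and N: "sigma_finite_measure N"
    and f: "integrable M f" and g: "integrable N g"
  shows "integrable (M \<Otimes>\<^sub>M N) (\<lambda>(x, y). f x * g y)"
proof -
  interpret M: sigma_finite_measure M by fact
  interpret N: sigma_finite_measure N by fact
  interpret pair_sigma_finite M N ..
  have [measurable]: "f \<in> borel_measurable M" "g \<in> borel_measurable N" using f g by auto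
  show ?thesis
    by (rule Fubini_integrable) (use f g in \<open>auto simp: abs_mult\<close>)
qed

text \<open>The product form matches \<open>lborel\<close> as a product measure over the basis, so
  that Fourier integrals factorise into one-dimensional ones.\<close>

definition gauss_density :: "'a::euclidean_space \<Rightarrow> real" where
  "gauss_density z = (\<Prod>b\<in>Basis. std_normal_density (z \<bullet> b))"

text \<open>The normalising constant is the one in \<open>fourier_transform\<close>; this is why
  powers of a single \<open>c\<close> cancel in the inversion formula.\<close>

lemma gauss_density_eq:
  "gauss_density (z::'a::euclidean_space) = (2 * pi) powr (- (real DIM('a) / 2)) * exp (- (norm z)\<^sup>2 / 2)"
proof -
  have "gauss_density z = (\<Prod>b\<in>(Basis::'a set). (1 / sqrt (2 * pi))) * exp (\<Sum>b\<in>Basis. - (z \<bullet> b)\<^sup>2 / 2)"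
    by (simp add: gauss_density_def std_normal_density_def exp_sum prod_dividef power_one_over)
  also have "(\<Sum>b\<in>Basis. - (z \<bullet> b)\<^sup>2 / 2) = - (norm z)\<^sup>2 / 2"
    unfolding power2_norm_eq_inner euclidean_inner[of z z]
    by (simp add: sum_negf sum_divide_distrib power2_eq_square)
  also have "(\<Prod>b\<in>(Basis::'a set). (1 / sqrt (2 * pi))) = (2 * pi) powr (- (real DIM('a) / 2))"
    by (simp add: powr_minus powr_half_sqrt[symmetric] powr_powr powr_realpow[symmetric]
        inverse_eq_divide power_divide)
  finally show ?thesis .
qed

lemma gauss_density_measurable [measurable]: "gauss_density \<in> borel_measurable borel"
  unfolding gauss_density_def[abs_def] by measurable

lemma gauss_density_nonneg: "0 \<le> gauss_density z"
  by (simp add: gauss_density_def prod_nonneg)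

text \<open>The left side is the characteristic function of the standard normal law, written as a
  Lebesgue integral.\<close>

lemma integral_std_normal_iexp:
  "(LINT x|lborel. iexp (t * x) * complex_of_real (std_normal_density x)) = exp (- (t\<^sup>2) / 2)"
proof -
  have "(LINT x|lborel. iexp (t * x) * complex_of_real (std_normal_density x))
      = (LINT x|lborel. std_normal_density x *\<^sub>R iexp (t * x))"
    by (simp add: scaleR_conv_of_real mult.commute)
  also have "\<dots> = char std_normal_distribution t"
    unfolding char_def by (rule integral_density[symmetric]) auto
  finally show ?thesis by (simp add: char_std_normal_distribution exp_of_real)
qed

lemma integrable_std_normal_iexp:
  "integrable lborel (\<lambda>x. iexp (t * x) * complex_of_real (std_normal_density x))"
  by (rule Bochner_Integration.integrable_bound[OF integrable_normal_density[of 1 0]])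
     (auto simp: norm_mult)

text \<open>Both claims become products over the basis directions, each factor being a
  one-dimensional Gaussian integral.\<close>

lemma
  fixes y :: "'a::euclidean_space"
  shows integral_gauss_iexp:
    "(LINT z|lborel. iexp (z \<bullet> y) * complex_of_real (gauss_density z)) = exp (- (norm y)\<^sup>2 / 2)"
    and integrable_gauss_density: "integrable lborel (gauss_density :: 'a \<Rightarrow> real)"
proof -
  interpret product_sigma_finite "\<lambda>_::'a. lborel :: real measure" ..
  define f where "f = (\<lambda>(y::'a) b x. iexp ((y \<bullet> b) * x) * complex_of_real (std_normal_density x))"
  have [measurable]: "f y b \<in> borel_measurable borel" for y b unfolding f_def by measurable
  have F: "iexp (z \<bullet> y) * complex_of_real (gauss_density z) = (\<Prod>b\<in>Basis. f y b (z \<bullet> b))" for z y :: 'a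
  proof -
    have "z \<bullet> y = (\<Sum>b\<in>Basis. (y \<bullet> b) * (z \<bullet> b))"
      by (subst euclidean_inner) (simp add: mult.commute)
    then show ?thesis
      by (simp add: f_def gauss_density_def prod.distrib exp_sum sum_distrib_left del: of_real_mult)
  qed
  have I: "integrable lborel (f y b)" for y b
    unfolding f_def by (rule integrable_std_normal_iexp)
  have "(LINT z|lborel. iexp (z \<bullet> y) * complex_of_real (gauss_density z))
      = (LINT z|distr (\<Pi>\<^sub>M b\<in>Basis. lborel) borel (\<lambda>f. \<Sum>b\<in>Basis. f b *\<^sub>R b). (\<Prod>b\<in>Basis. f y b (z \<bullet> b)))"
    unfolding F using lborel_eq[where 'a='a] by simp
  also have "\<dots> = (LINT x|(\<Pi>\<^sub>M b\<in>Basis. lborel). (\<Prod>b\<in>Basis. f y b (x b)))"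
    by (subst integral_distr) (auto cong: prod.cong)
  also have "\<dots> = (\<Prod>b\<in>Basis. LINT x|lborel. f y b x)"
    by (rule product_integral_prod) (auto intro: I)
  also have "\<dots> = (\<Prod>b\<in>Basis. exp (complex_of_real (- ((y \<bullet> b)\<^sup>2) / 2)))"
    unfolding f_def by (intro prod.cong refl) (subst integral_std_normal_iexp, simp only: exp_of_real)
  also have "\<dots> = exp (complex_of_real (\<Sum>b\<in>Basis. - ((y \<bullet> b)\<^sup>2) / 2))"
    by (simp add: exp_sum)
  also have "(\<Sum>b\<in>Basis. - ((y \<bullet> b)\<^sup>2) / 2) = - (norm y)\<^sup>2 / 2"
    unfolding power2_norm_eq_inner euclidean_inner[of y y]
    by (simp add: sum_negf sum_divide_distrib power2_eq_square)
  finally show "(LINT z|lborel. iexp (z \<bullet> y) * complex_of_real (gauss_density z)) = exp (- (norm y)\<^sup>2 / 2)"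
    by (simp only: exp_of_real)
  have "integrable (\<Pi>\<^sub>M b\<in>Basis. lborel) (\<lambda>x. \<Prod>b\<in>Basis. f 0 b (x b))"
    by (rule product_integrable_prod) (auto intro: I)
  then have "integrable (distr (\<Pi>\<^sub>M b\<in>Basis. lborel) borel (\<lambda>f. \<Sum>b\<in>Basis. f b *\<^sub>R b)) (\<lambda>z::'a. \<Prod>b\<in>Basis. f 0 b (z \<bullet> b))"
    by (subst integrable_distr_eq) (auto cong: prod.cong)
  then have "integrable lborel (\<lambda>z::'a. iexp (z \<bullet> 0) * complex_of_real (gauss_density z))"
    unfolding F using lborel_eq[where 'a='a] by simp
  \<comment> \<open>At \<open>y = 0\<close> the exponential is 1, so the norm of the integrand is
    the density itself.\<close>
  from integrable_norm[OF this] show "integrable lborel (gauss_density :: 'a \<Rightarrow> real)"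
    by (simp add: gauss_density_nonneg)
qed

lemma integral_gauss_density: "(LINT z|lborel. gauss_density (z::'a::euclidean_space)) = 1"
proof -
  have "complex_of_real (LINT z|lborel. gauss_density (z::'a)) = 1"
    using integral_gauss_iexp[of "0::'a"] by (simp add: integral_complex_of_real)
  then show ?thesis by (simp only: of_real_eq_1_iff)
qed

lemma scaleR_inverse_Suc_tendsto_zero:
  fixes z :: "'a::real_normed_vector"
  shows "(\<lambda>n. z /\<^sub>R real (Suc n)) \<longlonglongrightarrow> 0"
proof -
  have "(\<lambda>n. inverse (real (Suc n)) *\<^sub>R z) \<longlonglongrightarrow> 0 *\<^sub>R z"
    by (intro tendsto_scaleR LIMSEQ_inverse_real_of_nat tendsto_const)
  then show ?thesis by simp
qed

lemma fourier_transform_measurable [measurable]: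
  assumes [measurable]: "f \<in> borel_measurable borel"
  shows "fourier_transform f \<in> borel_measurable borel"
  unfolding fourier_transform_def[abs_def] by measurable

text \<open>Gaussian regularisation: the factor \<open>g n\<close> tends to 1 and makes Fubini
  available, and integrating out \<open>z\<close> leaves a Gaussian that concentrates at
  \<open>x\<close>. Both sides converge by dominated convergence, with majorants
  \<open>norm (fourier_transform f z)\<close> and \<open>B * gauss_density\<close>.\<close>

lemma fourier_inversion:
  fixes f :: "'a::euclidean_space \<Rightarrow> real"
  assumes cont: "continuous_on UNIV f" and bnd: "\<And>x. \<bar>f x\<bar> \<le> B" and int: "integrable lborel f"
    and intF: "integrable lborel (fourier_transform f)"
  shows "complex_of_real (f x) = complex_of_real ((2 * pi) powr (- (real DIM('a) / 2))) *
     (LINT z|lborel. iexp (z \<bullet> x) * fourier_transform f z)"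
proof -
  define c where "c = (2 * pi) powr (- (real DIM('a) / 2))"
  have c0: "c > 0" unfolding c_def by simp
  have [measurable]: "f \<in> borel_measurable borel" using cont by (rule borel_measurable_continuous_onI)
  have [measurable]: "fourier_transform f \<in> borel_measurable borel" by measurable
  \<comment> \<open>A Gaussian of width \<open>Suc n\<close>, normalised to the value 1 at the
    origin rather than to mass 1.\<close>
  define g where "g n z = exp (- (norm (z /\<^sub>R real (Suc n)))\<^sup>2 / 2)" for n and z :: 'a
  have g_gauss: "g n z = gauss_density (z /\<^sub>R real (Suc n)) / c" for n z
    using c0 by (simp add: g_def gauss_density_eq c_def)
  have [measurable]: "g n \<in> borel_measurable borel" for n unfolding g_gauss[abs_def] by measurable
  have g_int: "integrable lborel (g n)" for n
  proof -
    have "integrable (density (distr lborel borel (\<lambda>x. 0 + real (Suc n) *\<^sub>R x)) (\<lambda>_. ennreal (\<bar>real (Suc n)\<bar> ^ DIM('a)))) (g n)"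
      by (subst integrable_density, simp_all, subst integrable_distr_eq, simp_all)
         (simp add: g_gauss integrable_gauss_density)
    then show ?thesis using lborel_affine[of "real (Suc n)" "0::'a"] by (simp add: ennreal_power)
  qed
  \<comment> \<open>The definition of the transform contributes a factor \<open>c\<close>; writing
    \<open>g n\<close> and then the resulting exponential as \<open>gauss_density / c\<close>
    contributes \<open>1 / c\<close> twice. The outer \<open>c\<close> clears the remaining
    \<open>1 / c\<close>.\<close>
  have main: "c * (LINT z|lborel. iexp (z \<bullet> x) * fourier_transform f z * g n z)
      = (LINT y|lborel. f (x + y /\<^sub>R real (Suc n)) * gauss_density y)" for n
  proof -
    let ?N = "real (Suc n)"
    have intp: "integrable (lborel \<Otimes>\<^sub>M lborel)
        (\<lambda>(z, \<xi>). iexp (z \<bullet> (x - \<xi>)) * complex_of_real (f \<xi>) * complex_of_real (g n z))"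
    proof (rule Bochner_Integration.integrable_bound)
      show "integrable (lborel \<Otimes>\<^sub>M lborel) (\<lambda>(z, \<xi>). g n z * \<bar>f \<xi>\<bar>)"
        by (intro integrable_pair_mult g_int integrable_abs int sigma_finite_lborel)
    qed (auto simp: norm_mult case_prod_beta abs_mult mult.commute g_def)
    have "(LINT z|lborel. iexp (z \<bullet> x) * fourier_transform f z * g n z)
       = (LINT z|lborel. c * (LINT \<xi>|lborel. iexp (z \<bullet> (x - \<xi>)) * complex_of_real (f \<xi>) * complex_of_real (g n z)))"
    proof (intro Bochner_Integration.integral_cong refl)
      fix z :: 'a
      have "iexp (z \<bullet> x) * fourier_transform f z * g n z
         = c * (iexp (z \<bullet> x) * (LINT \<xi>|lborel. exp (- (\<i> * complex_of_real (z \<bullet> \<xi>))) * complex_of_real (f \<xi>)) * g n z)"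
        by (simp add: fourier_transform_def c_def)
      also have "\<dots> = c * (LINT \<xi>|lborel. iexp (z \<bullet> x) * (exp (- (\<i> * complex_of_real (z \<bullet> \<xi>))) * complex_of_real (f \<xi>)) * complex_of_real (g n z))"
        by simp
      also have "(\<lambda>\<xi>. iexp (z \<bullet> x) * (exp (- (\<i> * complex_of_real (z \<bullet> \<xi>))) * complex_of_real (f \<xi>)) * complex_of_real (g n z))
         = (\<lambda>\<xi>. iexp (z \<bullet> (x - \<xi>)) * complex_of_real (f \<xi>) * complex_of_real (g n z))"
        by (auto simp: inner_diff_right algebra_simps mult_exp_exp)
      finally show "iexp (z \<bullet> x) * fourier_transform f z * g n z =
         c * (LINT \<xi>|lborel. iexp (z \<bullet> (x - \<xi>)) * complex_of_real (f \<xi>) * complex_of_real (g n z))" .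
    qed
    also have "\<dots> = c * (LINT z|lborel. LINT \<xi>|lborel. iexp (z \<bullet> (x - \<xi>)) * complex_of_real (f \<xi>) * complex_of_real (g n z))"
      by simp
    also have "(LINT z|lborel. LINT \<xi>|lborel. iexp (z \<bullet> (x - \<xi>)) * complex_of_real (f \<xi>) * complex_of_real (g n z))
       = (LINT \<xi>|lborel. LINT z|lborel. iexp (z \<bullet> (x - \<xi>)) * complex_of_real (f \<xi>) * complex_of_real (g n z))"
      by (rule lborel_pair.Fubini_integral[OF intp, symmetric])
    also have "\<dots> = (LINT \<xi>|lborel. complex_of_real (f \<xi>) * (LINT z|lborel. iexp (z \<bullet> (x - \<xi>)) * complex_of_real (g n z)))"
      by (subst integral_mult_right_zero[symmetric]) (simp add: ac_simps)
    also have "\<dots> = (LINT \<xi>|lborel. complex_of_real (f \<xi> * ?N ^ DIM('a) * exp (- (norm (?N *\<^sub>R (x - \<xi>)))\<^sup>2 / 2) / c))"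
    proof (intro Bochner_Integration.integral_cong refl)
      fix \<xi>
      have "(LINT z|lborel. iexp (z \<bullet> (x - \<xi>)) * complex_of_real (g n z))
         = ?N ^ DIM('a) *\<^sub>R (LINT z|lborel. iexp ((0 + ?N *\<^sub>R z) \<bullet> (x - \<xi>)) * complex_of_real (g n (0 + ?N *\<^sub>R z)))"
        by (subst lborel_integral_affine[where c="?N" and t=0]) auto
      also have "(LINT z|lborel. iexp ((0 + ?N *\<^sub>R z) \<bullet> (x - \<xi>)) * complex_of_real (g n (0 + ?N *\<^sub>R z)))
         = (LINT z|lborel. iexp (z \<bullet> (?N *\<^sub>R (x - \<xi>))) * complex_of_real (gauss_density z)) / c"
        unfolding g_gauss by (subst integral_divide_zero[symmetric]) simp
      also have "\<dots> = exp (- (norm (?N *\<^sub>R (x - \<xi>)))\<^sup>2 / 2) / c"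
        by (subst integral_gauss_iexp) simp
      finally show "complex_of_real (f \<xi>) * (LINT z|lborel. iexp (z \<bullet> (x - \<xi>)) * complex_of_real (g n z)) =
         complex_of_real (f \<xi> * ?N ^ DIM('a) * exp (- (norm (?N *\<^sub>R (x - \<xi>)))\<^sup>2 / 2) / c)"
        by (simp add: scaleR_conv_of_real)
    qed
    also have "\<dots> = complex_of_real (LINT \<xi>|lborel. f \<xi> * ?N ^ DIM('a) * exp (- (norm (?N *\<^sub>R (x - \<xi>)))\<^sup>2 / 2) / c)"
      by (rule integral_complex_of_real)
    \<comment> \<open>The substitution \<open>\<xi> = x + y / N\<close> cancels the Jacobian
      \<open>N ^ DIM('a)\<close> left by the scaling in \<open>z\<close>.\<close>
    also have "(LINT \<xi>|lborel. f \<xi> * ?N ^ DIM('a) * exp (- (norm (?N *\<^sub>R (x - \<xi>)))\<^sup>2 / 2) / c)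
       = \<bar>1 / ?N\<bar> ^ DIM('a) * (LINT y|lborel. f (x + (1 / ?N) *\<^sub>R y) * ?N ^ DIM('a)
           * exp (- (norm (?N *\<^sub>R (x - (x + (1 / ?N) *\<^sub>R y))))\<^sup>2 / 2) / c)"
      by (subst lborel_integral_affine[where c="1 / ?N" and t=x]) auto
    also have "\<dots> = (LINT y|lborel. f (x + y /\<^sub>R ?N) * gauss_density y) / c\<^sup>2"
      unfolding integral_mult_right_zero[symmetric] integral_divide_zero[symmetric]
    proof (intro Bochner_Integration.integral_cong refl)
      have regroup: "a * (s * b * (r / c) / c) = s * r / c\<^sup>2" if "a * b = 1" for a b s r :: real
      proof -
        have "a * (s * b * (r / c) / c) = (a * b) * (s * r / c\<^sup>2)"
          by (simp add: power2_eq_square)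
        then show ?thesis using that by simp
      qed
      fix y :: 'a
      have e: "?N *\<^sub>R (x - (x + (1 / ?N) *\<^sub>R y)) = - y" by simp
      have "exp (- (norm y)\<^sup>2 / 2) = gauss_density y / c"
        using c0 by (simp add: gauss_density_eq c_def[symmetric])
      moreover have "\<bar>1 / ?N\<bar> ^ DIM('a) * ?N ^ DIM('a) = 1"
        by (simp add: power_mult_distrib[symmetric] del: of_nat_Suc)
      ultimately show "\<bar>1 / ?N\<bar> ^ DIM('a) * (f (x + (1 / ?N) *\<^sub>R y) * ?N ^ DIM('a)
           * exp (- (norm (?N *\<^sub>R (x - (x + (1 / ?N) *\<^sub>R y))))\<^sup>2 / 2) / c)
        = f (x + y /\<^sub>R ?N) * gauss_density y / c\<^sup>2"
        unfolding e norm_minus_cancel inverse_eq_divide by (simp only: regroup)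
    qed
    finally show ?thesis
      using c0 by (simp add: power2_eq_square)
  qed
  have lim1: "(\<lambda>n. LINT z|lborel. iexp (z \<bullet> x) * fourier_transform f z * g n z)
      \<longlonglongrightarrow> (LINT z|lborel. iexp (z \<bullet> x) * fourier_transform f z)"
  proof (rule integral_dominated_convergence[where w="\<lambda>z. norm (fourier_transform f z)"])
    show "AE z in lborel. (\<lambda>n. iexp (z \<bullet> x) * fourier_transform f z * g n z)
        \<longlonglongrightarrow> iexp (z \<bullet> x) * fourier_transform f z"
    proof (rule AE_I2)
      fix z :: 'a
      have "(\<lambda>n. z /\<^sub>R real (Suc n)) \<longlonglongrightarrow> 0"
        by (rule scaleR_inverse_Suc_tendsto_zero)
      then have "(\<lambda>n. g n z) \<longlonglongrightarrow> exp (- (norm (0::'a))\<^sup>2 / 2)"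
        unfolding g_def by (intro tendsto_intros) auto
      then have "(\<lambda>n. iexp (z \<bullet> x) * fourier_transform f z * complex_of_real (g n z))
          \<longlonglongrightarrow> iexp (z \<bullet> x) * fourier_transform f z * complex_of_real (exp (- (norm (0::'a))\<^sup>2 / 2))"
        by (intro tendsto_intros)
      then show "(\<lambda>n. iexp (z \<bullet> x) * fourier_transform f z * g n z)
        \<longlonglongrightarrow> iexp (z \<bullet> x) * fourier_transform f z" by simp
    qed
    show "AE z in lborel. norm (iexp (z \<bullet> x) * fourier_transform f z * complex_of_real (g n z))
        \<le> norm (fourier_transform f z)" for n
      by (rule AE_I2) (auto simp: norm_mult g_def intro!: mult_left_le)
  qed (use intF in auto)
  have lim2: "(\<lambda>n. LINT y|lborel. f (x + y /\<^sub>R real (Suc n)) * gauss_density y)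
      \<longlonglongrightarrow> (LINT y|lborel. f x * gauss_density (y::'a))"
  proof (rule integral_dominated_convergence[where w="\<lambda>z::'a. B * gauss_density z"])
    show "AE y in lborel. (\<lambda>n. f (x + y /\<^sub>R real (Suc n)) * gauss_density y) \<longlonglongrightarrow> f x * gauss_density y"
    proof (rule AE_I2)
      fix y :: 'a
      have "(\<lambda>n. y /\<^sub>R real (Suc n)) \<longlonglongrightarrow> 0"
        by (rule scaleR_inverse_Suc_tendsto_zero)
      then have "(\<lambda>n. x + y /\<^sub>R real (Suc n)) \<longlonglongrightarrow> x"
        using tendsto_add[OF tendsto_const[of x]] by fastforce
      then have "(\<lambda>n. f (x + y /\<^sub>R real (Suc n))) \<longlonglongrightarrow> f x"
        using cont by (intro continuous_on_tendsto_compose[OF cont]) auto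
      then show "(\<lambda>n. f (x + y /\<^sub>R real (Suc n)) * gauss_density y) \<longlonglongrightarrow> f x * gauss_density y"
        by (intro tendsto_intros)
    qed
    show "AE y in lborel. norm (f (x + y /\<^sub>R real (Suc n)) * gauss_density y) \<le> B * gauss_density y" for n
      by (rule AE_I2) (auto simp: abs_mult gauss_density_nonneg intro!: mult_right_mono bnd)
  qed (auto simp: integrable_gauss_density)
  have limF: "(\<lambda>n. complex_of_real c * (LINT z|lborel. iexp (z \<bullet> x) * fourier_transform f z * g n z))
      \<longlonglongrightarrow> complex_of_real c * (LINT z|lborel. iexp (z \<bullet> x) * fourier_transform f z)"
    by (intro tendsto_intros lim1)
  have limK: "(\<lambda>n. complex_of_real c * (LINT z|lborel. iexp (z \<bullet> x) * fourier_transform f z * g n z))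
      \<longlonglongrightarrow> complex_of_real (f x)"
    unfolding main using lim2 by (intro tendsto_of_real) (simp add: integral_gauss_density)
  show ?thesis unfolding c_def[symmetric] by (rule LIMSEQ_unique[OF limK limF])
qed

text \<open>By the mean value theorem the bound \<open>G\<close> on the derivative also bounds the
  difference quotients, so dominated convergence applies along every sequence of increments. The
  derivative is measurable as a pointwise limit of these quotients.\<close>

lemma has_real_derivative_integral:
  fixes f :: "real \<Rightarrow> 'a \<Rightarrow> real"
  assumes int: "\<And>\<tau>. integrable M (f \<tau>)"
    and der: "\<And>\<tau> z. z \<in> space M \<Longrightarrow> ((\<lambda>\<tau>. f \<tau> z) has_real_derivative f' \<tau> z) (at \<tau>)"
    and bnd: "\<And>\<tau> z. z \<in> space M \<Longrightarrow> \<bar>f' \<tau> z\<bar> \<le> G z"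
    and G: "integrable M G"
  shows "((\<lambda>\<tau>. LINT z|M. f \<tau> z) has_real_derivative (LINT z|M. f' x z)) (at x)"
proof -
  have mvt: "\<bar>f (x + h) z - f x z\<bar> \<le> G z * \<bar>h\<bar>" if "z \<in> space M" for z h
    using field_differentiable_bound[of UNIV "\<lambda>\<tau>. f \<tau> z" "\<lambda>\<tau>. f' \<tau> z" "G z" "x + h" x] der bnd that
    by simp
  have "((\<lambda>h. ((LINT z|M. f (x + h) z) - (LINT z|M. f x z)) / h) \<longlongrightarrow> (LINT z|M. f' x z)) (at 0)"
    unfolding tendsto_at_iff_sequentially comp_def
  proof (intro allI impI)
    fix X :: "nat \<Rightarrow> real" assume X: "\<forall>i. X i \<in> UNIV - {0}" and X0: "X \<longlonglongrightarrow> 0"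
    have lim: "(\<lambda>i. (f (x + X i) z - f x z) / X i) \<longlonglongrightarrow> f' x z" if "z \<in> space M" for z
      using der[OF that, of x] X X0
      unfolding DERIV_def tendsto_at_iff_sequentially comp_def by blast
    have "(\<lambda>i. LINT z|M. (f (x + X i) z - f x z) / X i) \<longlonglongrightarrow> (LINT z|M. f' x z)"
    proof (rule integral_dominated_convergence[where w=G])
      have meas: "(\<lambda>z. (f (x + X i) z - f x z) / X i) \<in> borel_measurable M" for i
        using int by (intro borel_measurable_divide borel_measurable_diff) auto
      then show "(\<lambda>z. (f (x + X i) z - f x z) / X i) \<in> borel_measurable M" for i .
      show "f' x \<in> borel_measurable M"
        by (rule borel_measurable_LIMSEQ_real[OF lim meas])
      show "AE z in M. norm ((f (x + X i) z - f x z) / X i) \<le> G z" for i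
        using mvt[of _ "X i"] X by (intro AE_I2) (auto simp: divide_le_eq)
    qed (use lim G in auto)
    then show "(\<lambda>i. ((LINT z|M. f (x + X i) z) - (LINT z|M. f x z)) / X i) \<longlonglongrightarrow> (LINT z|M. f' x z)"
      using int by simp
  qed
  then show ?thesis unfolding DERIV_def .
qed

text \<open>Averaging the inversion formula over \<open>x\<close> and \<open>- x\<close> replaces
  the exponential by a cosine, since \<open>K\<close> is even. Taking real parts then leaves the
  real density \<open>A\<close>, the real part of the transform times the inversion
  constant.\<close>

lemma spectral_representation:
  fixes K :: "'a::euclidean_space \<Rightarrow> real"
  assumes cont: "continuous_on UNIV K" and bnd: "\<And>x. \<bar>K x\<bar> \<le> B" and int: "integrable lborel K"
    and even: "\<And>x. K (- x) = K x"
    and A2: "integrable lborel (\<lambda>z. complex_of_real (1 + (norm z)\<^sup>2) * fourier_transform K z)"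
  obtains A where "integrable lborel A" "integrable lborel (\<lambda>z. (norm z)\<^sup>2 * A z)"
    "\<And>x. K x = (LINT z|lborel. cos (z \<bullet> x) * A z)"
proof
  define c where "c = (2 * pi) powr (- (real DIM('a) / 2))"
  define A where "A = (\<lambda>z. c * Re (fourier_transform K z))"
  have c0: "c \<ge> 0" unfolding c_def by simp
  have [measurable]: "K \<in> borel_measurable borel" using cont by (rule borel_measurable_continuous_onI)
  have [measurable]: "A \<in> borel_measurable borel" unfolding A_def by measurable
  \<comment> \<open>The weight dominates both 1 and \<open>(norm z)\<^sup>2\<close>, so (A2) yields
    integrability of the transform as well as its second moment.\<close>
  let ?W = "\<lambda>z. complex_of_real (1 + (norm z)\<^sup>2) * fourier_transform K z"
  have normW: "norm (?W z) = (1 + (norm z)\<^sup>2) * norm (fourier_transform K z)" for z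
    by (simp only: norm_mult norm_of_real) simp
  have intF: "integrable lborel (fourier_transform K)"
  proof (rule Bochner_Integration.integrable_bound[OF A2])
    show "AE z in lborel. norm (fourier_transform K z) \<le> norm (?W z)"
      unfolding normW by (rule AE_I2) (simp add: distrib_right)
  qed measurable
  have absA: "\<bar>A z\<bar> \<le> c * norm (fourier_transform K z)" for z
    unfolding A_def using c0 abs_Re_le_cmod[of "fourier_transform K z"]
    by (simp add: abs_mult mult_left_mono)
  show "integrable lborel A"
    by (rule Bochner_Integration.integrable_bound[of _ "\<lambda>z. c * norm (fourier_transform K z)"])
       (use intF absA c0 in \<open>auto intro!: AE_I2\<close>)
  show "integrable lborel (\<lambda>z. (norm z)\<^sup>2 * A z)"
  proof (rule Bochner_Integration.integrable_bound[of _ "\<lambda>z. c * norm (?W z)"])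
    show "AE z in lborel. norm ((norm z)\<^sup>2 * A z) \<le> norm (c * norm (?W z))"
    proof (rule AE_I2)
      fix z
      have "norm ((norm z)\<^sup>2 * A z) \<le> (norm z)\<^sup>2 * (c * norm (fourier_transform K z))"
        by (simp add: abs_mult mult_left_mono absA)
      also have "\<dots> \<le> (1 + (norm z)\<^sup>2) * (c * norm (fourier_transform K z))"
        using c0 by (intro mult_right_mono) auto
      finally show "norm ((norm z)\<^sup>2 * A z) \<le> norm (c * norm (?W z))"
        unfolding normW using c0 by (simp add: ac_simps)
    qed
    show "integrable lborel (\<lambda>z. c * norm (?W z))"
      by (intro integrable_mult_right integrable_norm A2)
  qed measurable
  show "K x = (LINT z|lborel. cos (z \<bullet> x) * A z)" for x
  proof -
    have intE: "integrable lborel (\<lambda>z. iexp (z \<bullet> y) * fourier_transform K z)" for y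
      by (rule Bochner_Integration.integrable_bound[OF intF]) (auto simp: norm_mult)
    have euler: "iexp (z \<bullet> x) + iexp (z \<bullet> (- x)) = complex_of_real (2 * cos (z \<bullet> x))" for z
      unfolding cis_conv_exp[symmetric] by (simp add: complex_eq_iff)
    have "complex_of_real (K x) + complex_of_real (K (- x)) = complex_of_real c *
      ((LINT z|lborel. iexp (z \<bullet> x) * fourier_transform K z)
        + (LINT z|lborel. iexp (z \<bullet> (- x)) * fourier_transform K z))"
      unfolding c_def distrib_left
      by (subst (1 2) fourier_inversion[OF cont bnd int intF]) simp
    also have "\<dots> = complex_of_real c *
      (LINT z|lborel. iexp (z \<bullet> x) * fourier_transform K z + iexp (z \<bullet> (- x)) * fourier_transform K z)"
      by (subst Bochner_Integration.integral_add[OF intE intE]) simp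
    also have "\<dots> = complex_of_real c * (LINT z|lborel. complex_of_real (2 * cos (z \<bullet> x)) * fourier_transform K z)"
      unfolding distrib_right[symmetric] euler ..
    finally have "Re (complex_of_real (K x) + complex_of_real (K (- x))) =
       Re (complex_of_real c * (LINT z|lborel. complex_of_real (2 * cos (z \<bullet> x)) * fourier_transform K z))"
      by simp
    also have "\<dots> = c * Re (LINT z|lborel. complex_of_real (2 * cos (z \<bullet> x)) * fourier_transform K z)"
      by simp
    also have "Re (LINT z|lborel. complex_of_real (2 * cos (z \<bullet> x)) * fourier_transform K z)
       = (LINT z|lborel. Re (complex_of_real (2 * cos (z \<bullet> x)) * fourier_transform K z))"
      by (rule integral_Re[symmetric], rule Bochner_Integration.integrable_bound[of _ "\<lambda>z. 2 *\<^sub>R fourier_transform K z"])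
         (use intF in \<open>auto simp: norm_mult intro!: AE_I2 mult_left_le_one_le\<close>)
    also have "c * \<dots> = (LINT z|lborel. 2 * (cos (z \<bullet> x) * A z))"
      by (subst integral_mult_right_zero[symmetric]) (simp add: A_def ac_simps)
    finally show ?thesis by (simp add: even)
  qed
qed

section \<open>Kernels with bounded second derivatives\<close>

text \<open>A Gateaux gradient: directional derivatives that are linear in the direction. This is
  what \<open>transport_op\<close> sees, and it can be checked along lines by differentiating under
  an integral. Measurability is bundled in because gradients are integrated.\<close>

definition has_grad :: "('a::euclidean_space \<Rightarrow> real) \<Rightarrow> ('a \<Rightarrow> 'a) \<Rightarrow> bool" where
  "has_grad f Df \<longleftrightarrow>
     (\<forall>x v. ((\<lambda>\<tau>. f (x + \<tau> *\<^sub>R v)) has_real_derivative Df x \<bullet> v) (at 0)) \<and>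
     Df \<in> borel_measurable borel"

lemma has_gradD:
  assumes "has_grad f Df"
  shows "((\<lambda>\<tau>. f (x + \<tau> *\<^sub>R v)) has_real_derivative Df (x + \<tau> *\<^sub>R v) \<bullet> v) (at \<tau>)"
proof -
  have "((\<lambda>s. f ((x + \<tau> *\<^sub>R v) + s *\<^sub>R v)) has_real_derivative Df (x + \<tau> *\<^sub>R v) \<bullet> v) (at 0)"
    using assms unfolding has_grad_def by blast
  then have "((\<lambda>s. f (x + (s + \<tau>) *\<^sub>R v)) has_real_derivative Df (x + \<tau> *\<^sub>R v) \<bullet> v) (at 0)"
    by (simp add: scaleR_add_left add.assoc add.commute[of "\<tau> *\<^sub>R v"])
  then show ?thesis
    using DERIV_shift[of "\<lambda>s. f (x + s *\<^sub>R v)" _ 0 \<tau>] by simp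
qed

lemma has_grad_measurable [measurable_dest]: "has_grad f Df \<Longrightarrow> Df \<in> borel_measurable borel"
  by (simp add: has_grad_def)

text \<open>Makes the later choice of a gradient by \<open>SOME\<close> harmless.\<close>

lemma has_grad_unique:
  assumes "has_grad f Df" "has_grad f Df'"
  shows "Df = Df'"
proof
  fix x
  have "Df x \<bullet> v = Df' x \<bullet> v" for v
    using assms unfolding has_grad_def by (meson DERIV_unique)
  then show "Df x = Df' x" by (metis euclidean_eqI)
qed

lemma has_grad_add:
  assumes "has_grad f Df" "has_grad g Dg"
  shows "has_grad (\<lambda>x. f x + g x) (\<lambda>x. Df x + Dg x)"
  using assms unfolding has_grad_def by (auto simp: inner_add_left intro: DERIV_add)

lemma has_grad_scale:
  assumes "has_grad f Df"
  shows "has_grad (\<lambda>x. c * f x) (\<lambda>x. c *\<^sub>R Df x)"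
  using assms unfolding has_grad_def by (auto intro: DERIV_cmult)

lemma has_grad_shift:
  assumes "has_grad f Df"
  shows "has_grad (\<lambda>x. f (x - y)) (\<lambda>x. Df (x - y))"
proof -
  have [measurable]: "Df \<in> borel_measurable borel" using assms by (rule has_grad_measurable)
  have "((\<lambda>\<tau>. f ((x - y) + \<tau> *\<^sub>R v)) has_real_derivative Df (x - y) \<bullet> v) (at 0)" for x v
    using assms unfolding has_grad_def by blast
  then show ?thesis unfolding has_grad_def by (simp add: algebra_simps)
qed

text \<open>\<open>Hs x\<close> is the Hessian of \<open>K\<close> at \<open>x\<close>, as a linear map.\<close>

locale smooth_even_kernel =
  fixes K :: "'a::euclidean_space \<Rightarrow> real" and g :: "'a \<Rightarrow> 'a" and Hs :: "'a \<Rightarrow> 'a \<Rightarrow> 'a" and C :: real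
  assumes even: "K (- x) = K x"
    and grad: "has_grad K g"
    and hess: "((\<lambda>\<tau>. g (x + \<tau> *\<^sub>R v) \<bullet> w) has_real_derivative Hs (x + \<tau> *\<^sub>R v) w \<bullet> v) (at \<tau>)"
    and hess_measurable [measurable]: "(\<lambda>(x, v). Hs x v) \<in> borel_measurable (borel \<Otimes>\<^sub>M borel)"
    and kernel_bound: "\<bar>K x\<bar> \<le> C"
    and grad_bound: "norm (g x) \<le> C"
    and hess_bound: "norm (Hs x v) \<le> C * norm v"
    and grad_zero: "g 0 = 0"
    and kernel_measurable [measurable]: "K \<in> borel_measurable borel"

context smooth_even_kernel
begin

text \<open>Evenness allows the second argument, on which the operator acts first, to carry the plus
  sign.\<close>

lemma translation_kernel_swap: "translation_kernel K \<xi> \<eta> = K (\<eta> - \<xi>)"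
  using even[of "\<xi> - \<eta>"] by (simp add: translation_kernel_def)

lemma grad_measurable [measurable]: "g \<in> borel_measurable borel"
  using grad by (rule has_grad_measurable)

lemma hess_measurable_comp [measurable]:
  assumes "f \<in> borel_measurable N" "h \<in> borel_measurable N"
  shows "(\<lambda>x. Hs (f x) (h x)) \<in> borel_measurable N"
  using measurable_compose[OF measurable_Pair[OF assms] hess_measurable] by simp

end

text \<open>Each derivative of \<open>cos (z \<bullet> x)\<close> costs a factor
  \<open>norm z\<close>, and the second moment of \<open>A\<close> pays for two of them. The
  gradient vanishes at 0 because it is a sine integral.\<close>

lemma cosine_transform_smooth:
  fixes K :: "'a::euclidean_space \<Rightarrow> real"
  assumes A: "integrable lborel A" and A2: "integrable lborel (\<lambda>z. (norm z)\<^sup>2 * A z)"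
    and K: "\<And>x. K x = (LINT z|lborel. cos (z \<bullet> x) * A z)"
  obtains g Hs C where "smooth_even_kernel K g Hs C"
proof -
  have [measurable]: "A \<in> borel_measurable borel" using A by auto
  \<comment> \<open>One weight dominates \<open>A\<close> multiplied by \<open>norm z\<close> to the
    powers 0, 1 and 2, so its integral \<open>C\<close> serves as the bound for \<open>K\<close>,
    \<open>g\<close> and \<open>Hs\<close> alike.\<close>
  define W where "W z = (1 + (norm z)\<^sup>2) * \<bar>A z\<bar>" for z
  have W: "integrable lborel W"
  proof -
    have "W = (\<lambda>z. \<bar>A z\<bar> + \<bar>(norm z)\<^sup>2 * A z\<bar>)" by (auto simp: W_def abs_mult distrib_right)
    then show ?thesis using A A2 by auto
  qed
  have W0: "\<bar>A z\<bar> \<le> W z" for z by (simp add: W_def distrib_right)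
  have W1: "norm z * \<bar>A z\<bar> \<le> W z" for z
  proof -
    have "norm z \<le> 1 + (norm z)\<^sup>2"
      using zero_le_power2[of "norm z - 1"] norm_ge_zero[of z] unfolding power2_diff one_power2 by linarith
    then show ?thesis unfolding W_def by (intro mult_right_mono) auto
  qed
  have W2: "norm z * norm z * \<bar>A z\<bar> \<le> W z" for z by (simp add: W_def distrib_right power2_eq_square)
  have W_nonneg: "0 \<le> W z" for z by (simp add: W_def)
  define C where "C = (LINT z|lborel. W z)"
  define g where "g x = (LINT z|lborel. - (sin (z \<bullet> x) * A z) *\<^sub>R z)" for x
  define Hs where "Hs x v = (LINT z|lborel. - (cos (z \<bullet> x) * A z * (z \<bullet> v)) *\<^sub>R z)" for x v
  have ib: "integrable lborel h" if [measurable]: "h \<in> borel_measurable borel" and "\<And>z. norm (h z) \<le> W z * c"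
    for h :: "'a \<Rightarrow> 'b::{banach, second_countable_topology}" and c
    by (rule Bochner_Integration.integrable_bound[of _ "\<lambda>z. W z * c"])
       (use W that in \<open>auto intro!: AE_I2 order_trans[OF _ abs_ge_self]\<close>)
  have ibn: "norm (LINT z|lborel. h z) \<le> C * c"
    if [measurable]: "h \<in> borel_measurable borel" and b: "\<And>z. norm (h z) \<le> W z * c"
    for h :: "'a \<Rightarrow> 'b::{banach, second_countable_topology}" and c
  proof -
    have "norm (LINT z|lborel. h z) \<le> (LINT z|lborel. W z * c)"
      by (rule Bochner_Integration.integral_norm_bound_integral[OF ib[OF that]]) (use W b in auto)
    then show ?thesis by (simp add: C_def)
  qed
  have b0: "\<bar>cos r * A z\<bar> \<le> W z * 1" for r z
    using mult_right_mono[OF abs_cos_le_one[of r], of "\<bar>A z\<bar>"] W0[of z] by (simp add: abs_mult)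
  have b1: "norm (- (sin r * A z) *\<^sub>R z) \<le> W z * 1" for r z
    using mult_right_mono[OF abs_sin_le_one[of r], of "norm z * \<bar>A z\<bar>"] W1[of z] by (simp add: abs_mult mult_ac)
  have b2: "norm (- (cos r * A z * (z \<bullet> v)) *\<^sub>R z) \<le> W z * norm v" for r z v
  proof -
    have "norm (- (cos r * A z * (z \<bullet> v)) *\<^sub>R z) = \<bar>cos r\<bar> * (\<bar>A z\<bar> * norm z * \<bar>z \<bullet> v\<bar>)"
      by (simp add: abs_mult mult_ac)
    also have "\<dots> \<le> 1 * (\<bar>A z\<bar> * norm z * (norm z * norm v))"
      by (intro mult_mono) (auto simp: Cauchy_Schwarz_ineq2 abs_cos_le_one)
    also have "\<dots> \<le> W z * norm v"
      using mult_right_mono[OF W2[of z], of "norm v"] by (simp add: mult_ac)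
    finally show ?thesis .
  qed
  have ig: "integrable lborel (\<lambda>z. - (sin (z \<bullet> x) * A z) *\<^sub>R z)" for x by (rule ib[OF _ b1]) measurable
  have iH: "integrable lborel (\<lambda>z. - (cos (z \<bullet> x) * A z * (z \<bullet> v)) *\<^sub>R z)" for x v by (rule ib[OF _ b2]) measurable
  have [measurable]: "g \<in> borel_measurable borel" unfolding g_def[abs_def] by measurable
  have dK: "((\<lambda>\<tau>. K (x + \<tau> *\<^sub>R v)) has_real_derivative g x \<bullet> v) (at 0)" for x v
  proof -
    have "((\<lambda>\<tau>. LINT z|lborel. cos (z \<bullet> (x + \<tau> *\<^sub>R v)) * A z) has_real_derivative
        (LINT z|lborel. (- (sin (z \<bullet> (x + 0 *\<^sub>R v)) * A z) *\<^sub>R z) \<bullet> v)) (at 0)"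
    proof (rule has_real_derivative_integral[where G="\<lambda>z. W z * 1 * norm v"])
      show "integrable lborel (\<lambda>z. cos (z \<bullet> (x + \<tau> *\<^sub>R v)) * A z)" for \<tau>
        by (rule ib) (measurable, unfold real_norm_def, rule b0)
      show "((\<lambda>\<tau>. cos (z \<bullet> (x + \<tau> *\<^sub>R v)) * A z) has_real_derivative
          (- (sin (z \<bullet> (x + \<tau> *\<^sub>R v)) * A z) *\<^sub>R z) \<bullet> v) (at \<tau>)" for \<tau> z
        unfolding inner_add_right inner_scaleR_right
        by (auto intro!: derivative_eq_intros)
      show "\<bar>(- (sin (z \<bullet> (x + \<tau> *\<^sub>R v)) * A z) *\<^sub>R z) \<bullet> v\<bar> \<le> W z * 1 * norm v" for \<tau> z
        by (rule order_trans[OF Cauchy_Schwarz_ineq2 mult_right_mono[OF b1 norm_ge_zero]])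
    qed (use W in auto)
    then show ?thesis unfolding K g_def by (simp only: integral_inner_left[OF ig] scaleR_zero_left add_0_right)
  qed
  have dg: "((\<lambda>\<tau>. g (x + \<tau> *\<^sub>R v) \<bullet> w) has_real_derivative Hs (x + \<tau> *\<^sub>R v) w \<bullet> v) (at \<tau>)" for x v w \<tau>
  proof -
    have "((\<lambda>\<tau>. LINT z|lborel. (- (sin (z \<bullet> (x + \<tau> *\<^sub>R v)) * A z) *\<^sub>R z) \<bullet> w) has_real_derivative
        (LINT z|lborel. (- (cos (z \<bullet> (x + \<tau> *\<^sub>R v)) * A z * (z \<bullet> w)) *\<^sub>R z) \<bullet> v)) (at \<tau>)"
    proof (rule has_real_derivative_integral[where G="\<lambda>z. W z * norm w * norm v"])
      show "integrable lborel (\<lambda>z. (- (sin (z \<bullet> (x + \<tau> *\<^sub>R v)) * A z) *\<^sub>R z) \<bullet> w)" for \<tau>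
        using ig by (intro integrable_inner_left)
      show "((\<lambda>\<tau>. (- (sin (z \<bullet> (x + \<tau> *\<^sub>R v)) * A z) *\<^sub>R z) \<bullet> w) has_real_derivative
          (- (cos (z \<bullet> (x + \<tau> *\<^sub>R v)) * A z * (z \<bullet> w)) *\<^sub>R z) \<bullet> v) (at \<tau>)" for \<tau> z
        unfolding inner_add_right inner_scaleR_right inner_scaleR_left
        by (auto intro!: derivative_eq_intros)
      show "\<bar>(- (cos (z \<bullet> (x + \<tau> *\<^sub>R v)) * A z * (z \<bullet> w)) *\<^sub>R z) \<bullet> v\<bar> \<le> W z * norm w * norm v" for \<tau> z
        by (rule order_trans[OF Cauchy_Schwarz_ineq2 mult_right_mono[OF b2 norm_ge_zero]])
    qed (use W in auto)
    then show ?thesis unfolding g_def Hs_def by (simp only: integral_inner_left[OF ig] integral_inner_left[OF iH])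
  qed
  have "smooth_even_kernel K g Hs C"
  proof
    show "K (- x) = K x" for x by (simp add: K)
    show "has_grad K g" unfolding has_grad_def using dK by auto
    show "(\<lambda>(x, v). Hs x v) \<in> borel_measurable (borel \<Otimes>\<^sub>M borel)" unfolding Hs_def by measurable
    show "\<bar>K x\<bar> \<le> C" for x using ibn[of "\<lambda>z. cos (z \<bullet> x) * A z" 1] b0 by (simp add: K)
    show "norm (g x) \<le> C" for x using ibn[OF _ b1, of "\<lambda>z. z \<bullet> x"] by (simp add: g_def)
    show "norm (Hs x v) \<le> C * norm v" for x v using ibn[OF _ b2, of "\<lambda>z. z \<bullet> x"] by (simp add: Hs_def)
    show "g 0 = 0" by (simp add: g_def)
    show "K \<in> borel_measurable borel" unfolding K[abs_def] by measurable
  qed (rule dg)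
  then show thesis by (rule that)
qed

section \<open>Representers in the reproducing kernel Hilbert space\<close>

context rkhs
begin

lemma diff_mem: "\<lbrakk>f \<in> H; g \<in> H\<rbrakk> \<Longrightarrow> (\<lambda>\<xi>. f \<xi> - g \<xi>) \<in> H"
  using add_mem[OF _ scale_mem[of g "- 1"], of f] by simp

lemma ip_add_right: "\<lbrakk>f \<in> H; g \<in> H; h \<in> H\<rbrakk> \<Longrightarrow> ip h (\<lambda>\<xi>. f \<xi> + g \<xi>) = ip h f + ip h g"
  using ip_add[of f g h] ip_sym[of h "\<lambda>\<xi>. f \<xi> + g \<xi>"] ip_sym[of h f] ip_sym[of h g] add_mem[of f g] by simp

lemma ip_scale_right: "\<lbrakk>f \<in> H; g \<in> H\<rbrakk> \<Longrightarrow> ip g (\<lambda>\<xi>. c * f \<xi>) = c * ip g f"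
  using ip_scale[of f g c] ip_sym[of g "\<lambda>\<xi>. c * f \<xi>"] ip_sym[of g f] scale_mem[of f c] by simp

lemma ip_diff: "\<lbrakk>f \<in> H; g \<in> H; h \<in> H\<rbrakk> \<Longrightarrow> ip (\<lambda>\<xi>. f \<xi> - g \<xi>) h = ip f h - ip g h"
  using ip_add[OF _ scale_mem[of g "- 1"], of f h] ip_scale[of g h "- 1"] by simp

lemma ip_diff_right: "\<lbrakk>f \<in> H; g \<in> H; h \<in> H\<rbrakk> \<Longrightarrow> ip h (\<lambda>\<xi>. f \<xi> - g \<xi>) = ip h f - ip h g"
  using ip_diff[of f g h] ip_sym[of h "\<lambda>\<xi>. f \<xi> - g \<xi>"] ip_sym[of h f] ip_sym[of h g] diff_mem[of f g] by simp

lemma norm_sq: "f \<in> H \<Longrightarrow> (rkhs_norm ip f)\<^sup>2 = ip f f"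
  by (simp add: rkhs_norm_def ip_nonneg)

lemma norm_nonneg: "f \<in> H \<Longrightarrow> 0 \<le> rkhs_norm ip f"
  by (simp add: rkhs_norm_def ip_nonneg)

text \<open>This quadratic in \<open>c\<close> is used three times: at its minimiser for
  Cauchy-Schwarz, at \<open>c = - 1\<close> for the parallelogram law, and for all \<open>c\<close>
  as a first variation.\<close>

lemma ip_line:
  assumes "f \<in> H" "g \<in> H"
  shows "ip (\<lambda>\<xi>. f \<xi> + c * g \<xi>) (\<lambda>\<xi>. f \<xi> + c * g \<xi>) = ip f f + 2 * c * ip f g + c\<^sup>2 * ip g g"
  using assms scale_mem[of g c] ip_sym[of f g]
  by (simp add: ip_add ip_add_right ip_scale ip_scale_right add_mem algebra_simps power2_eq_square)

lemma Cauchy_Schwarz: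
  assumes f: "f \<in> H" and g: "g \<in> H"
  shows "\<bar>ip f g\<bar> \<le> rkhs_norm ip f * rkhs_norm ip g"
proof (cases "ip g g = 0")
  case True
  then have "g = (\<lambda>\<xi>. 0 * g \<xi>)" using ip_definite[OF g] by simp
  then have "ip f g = 0" using ip_scale_right[OF g f, of 0] by simp
  then show ?thesis using norm_nonneg f g by simp
next
  case False
  then have pos: "ip g g > 0" using ip_nonneg[OF g] by simp
  have "0 \<le> ip f f + 2 * (- ip f g / ip g g) * ip f g + (- ip f g / ip g g)\<^sup>2 * ip g g"
    unfolding ip_line[OF f g, symmetric] by (intro ip_nonneg add_mem scale_mem f g)
  also have "\<dots> = ip f f - (ip f g)\<^sup>2 / ip g g"
    using False by (simp add: field_simps power2_eq_square)
  finally have "(ip f g)\<^sup>2 \<le> ip f f * ip g g"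
    using pos by (simp add: field_simps)
  then have "(ip f g)\<^sup>2 \<le> (rkhs_norm ip f * rkhs_norm ip g)\<^sup>2"
    by (simp add: power_mult_distrib norm_sq f g)
  then have "\<bar>ip f g\<bar> \<le> \<bar>rkhs_norm ip f * rkhs_norm ip g\<bar>"
    by (simp only: abs_le_square_iff)
  then show ?thesis
    using norm_nonneg[OF f] norm_nonneg[OF g] by (simp add: abs_mult)
qed

text \<open>
  \<open>V\<close> need not be closed: a minimising sequence in \<open>V\<close> of \<open>f \<mapsto> ip f f - 2 * L f\<close> is Cauchy
  by the parallelogram law, and its limit represents \<open>L\<close>.
\<close>

lemma Riesz_on_subspace:
  assumes VH: "V \<subseteq> H" and V0: "(\<lambda>\<xi>. 0) \<in> V"
    and Vadd: "\<And>f g. \<lbrakk>f \<in> V; g \<in> V\<rbrakk> \<Longrightarrow> (\<lambda>\<xi>. f \<xi> + g \<xi>) \<in> V"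
    and Vscale: "\<And>f c. f \<in> V \<Longrightarrow> (\<lambda>\<xi>. c * f \<xi>) \<in> V"
    and Ladd: "\<And>f g. \<lbrakk>f \<in> V; g \<in> V\<rbrakk> \<Longrightarrow> L (\<lambda>\<xi>. f \<xi> + g \<xi>) = L f + L g"
    and Lscale: "\<And>f c. f \<in> V \<Longrightarrow> L (\<lambda>\<xi>. c * f \<xi>) = c * L f"
    and Lbound: "\<And>f. f \<in> V \<Longrightarrow> \<bar>L f\<bar> \<le> C * rkhs_norm ip f"
  obtains g where "g \<in> H" "\<And>f. f \<in> V \<Longrightarrow> ip g f = L f"
proof -
  note VHD = subsetD[OF VH]
  define J where "J f = ip f f - 2 * L f" for f
  \<comment> \<open>Completing the square: the norm \<open>n\<close> of \<open>f\<close> satisfies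
    \<open>n\<^sup>2 - 2 * C * n \<ge> - C\<^sup>2\<close>.\<close>
  have J_ge: "- C\<^sup>2 \<le> J f" if f: "f \<in> V" for f
  proof -
    have "0 \<le> (rkhs_norm ip f - C)\<^sup>2" by simp
    then show ?thesis
      using Lbound[OF f] norm_sq[OF VHD[OF f]] unfolding J_def power2_diff by (simp add: mult_ac)
  qed
  define m where "m = (INF f\<in>V. J f)"
  have bdd: "bdd_below (J ` V)" using J_ge by (rule bdd_belowI2)
  have m_le: "m \<le> J f" if "f \<in> V" for f unfolding m_def using that bdd by (rule cINF_lower[rotated])
  have "\<exists>f\<in>V. J f < m + 1 / real (Suc n)" for n
    using cINF_less_iff[of V J "m + 1 / real (Suc n)"] V0 bdd unfolding m_def[symmetric] by auto
  then obtain F where FV: "\<And>n. F n \<in> V" and FJ: "\<And>n. J (F n) < m + 1 / real (Suc n)" by metis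
  have FH: "F n \<in> H" for n using FV VHD by blast
  have par: "ip (\<lambda>\<xi>. f \<xi> - h \<xi>) (\<lambda>\<xi>. f \<xi> - h \<xi>) \<le> 2 * (J f - m) + 2 * (J h - m)"
    if f: "f \<in> V" and h: "h \<in> V" for f h
  proof -
    note fh = VHD[OF f] VHD[OF h]
    \<comment> \<open>The midpoint lies in \<open>V\<close>, so its \<open>J\<close> is at least
      \<open>m\<close>; this forces two near-minimisers to be close to each other.\<close>
    have "4 * m \<le> 4 * J (\<lambda>\<xi>. 1 / 2 * (f \<xi> + h \<xi>))"
      using m_le[OF Vscale[OF Vadd[OF f h]], of "1 / 2"] by simp
    also have "\<dots> = ip f f + 2 * ip f h + ip h h - 4 * L f - 4 * L h"
      unfolding J_def using fh ip_sym[of f h]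
      by (simp only: Lscale Vadd f h Ladd ip_scale ip_scale_right scale_mem add_mem ip_add ip_add_right)
        (simp add: field_simps)
    finally show ?thesis
      unfolding J_def using ip_line[OF fh, of "- 1"] by simp
  qed
  have small: "rkhs_norm ip (\<lambda>\<xi>. F p \<xi> - F q \<xi>) < e"
    if e: "0 < e" and N: "4 / e\<^sup>2 < real (Suc N)" and pq: "N \<le> p" "N \<le> q" for e N p q
  proof -
    have le: "J (F n) - m \<le> 1 / real (Suc N)" if "N \<le> n" for n
      using FJ[of n] frac_le[of 1 1 "real (Suc N)" "real (Suc n)"] that by simp
    have "ip (\<lambda>\<xi>. F p \<xi> - F q \<xi>) (\<lambda>\<xi>. F p \<xi> - F q \<xi>) \<le> 4 / real (Suc N)"
      using par[OF FV FV, of p q] le[OF pq(1)] le[OF pq(2)] by simp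
    also have "\<dots> < e\<^sup>2"
      using N e by (simp add: field_simps del: of_nat_Suc)
    finally show ?thesis
      unfolding rkhs_norm_def using e by (intro real_less_lsqrt) auto
  qed
  have "\<exists>N. \<forall>p\<ge>N. \<forall>q\<ge>N. rkhs_norm ip (\<lambda>\<xi>. F p \<xi> - F q \<xi>) < e" if "0 < e" for e
  proof -
    obtain N where "4 / e\<^sup>2 < real N" using reals_Archimedean2 by blast
    then have "4 / e\<^sup>2 < real (Suc N)" by simp
    then show ?thesis using small[OF that] by blast
  qed
  from complete[OF FH this] obtain g where gH: "g \<in> H"
    and lim: "(\<lambda>n. rkhs_norm ip (\<lambda>\<xi>. F n \<xi> - g \<xi>)) \<longlonglongrightarrow> 0" by blast
  have "ip g f = L f" if f: "f \<in> V" for f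
  proof -
    note fH = VHD[OF f]
    have ipl: "(\<lambda>n. ip (F n) f) \<longlonglongrightarrow> ip g f"
    proof (rule LIM_zero_cancel, rule Lim_null_comparison)
      show "\<forall>\<^sub>F n in sequentially. norm (ip (F n) f - ip g f)
          \<le> rkhs_norm ip (\<lambda>\<xi>. F n \<xi> - g \<xi>) * rkhs_norm ip f"
        using Cauchy_Schwarz[OF diff_mem[OF FH gH] fH] ip_diff[OF FH gH fH] by (intro always_eventually) simp
      show "(\<lambda>n. rkhs_norm ip (\<lambda>\<xi>. F n \<xi> - g \<xi>) * rkhs_norm ip f) \<longlonglongrightarrow> 0"
        using tendsto_mult_left_zero[OF lim] .
    qed
    \<comment> \<open>First variation at the limit \<open>g\<close>. As \<open>g\<close> may lie
      outside \<open>V\<close>, the comparison is made at \<open>F n\<close>, and the summand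
      \<open>inverse (real (Suc n))\<close> is the slack of \<open>F n\<close> above the
      infimum.\<close>
    have key: "0 \<le> c\<^sup>2 * ip f f + 2 * c * (ip g f - L f)" for c
    proof (rule LIMSEQ_le_const)
      show "(\<lambda>n. inverse (real (Suc n)) + (c\<^sup>2 * ip f f + 2 * c * (ip (F n) f - L f)))
          \<longlonglongrightarrow> c\<^sup>2 * ip f f + 2 * c * (ip g f - L f)"
        by (rule tendsto_eq_rhs[OF tendsto_add[OF LIMSEQ_inverse_real_of_nat]])
           (auto intro!: tendsto_intros ipl)
      have "0 \<le> inverse (real (Suc n)) + (c\<^sup>2 * ip f f + 2 * c * (ip (F n) f - L f))" for n
      proof -
        have "m \<le> J (\<lambda>\<xi>. F n \<xi> + c * f \<xi>)" by (intro m_le Vadd Vscale FV f)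
        also have "\<dots> = J (F n) + (c\<^sup>2 * ip f f + 2 * c * (ip (F n) f - L f))"
          unfolding J_def ip_line[OF FH fH] by (simp add: Ladd Lscale Vscale FV f algebra_simps)
        finally show ?thesis using FJ[of n] by (simp add: inverse_eq_divide)
      qed
      then show "\<exists>N. \<forall>n\<ge>N. 0 \<le> inverse (real (Suc n)) + (c\<^sup>2 * ip f f + 2 * c * (ip (F n) f - L f))"
        by blast
    qed
    define a b where "a = ip f f" and "b = ip g f - L f"
    have a: "a \<ge> 0" unfolding a_def using ip_nonneg[OF fH] .
    \<comment> \<open>A quadratic \<open>c\<^sup>2 * a + 2 * c * b\<close> that is nonnegative for
      all \<open>c\<close> has \<open>b = 0\<close>. The denominator \<open>a + 1\<close> covers the
      case \<open>a = 0\<close>.\<close>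
    have "0 \<le> (- b / (a + 1))\<^sup>2 * a + 2 * (- b / (a + 1)) * b"
      using key[of "- b / (a + 1)"] unfolding a_def b_def .
    also have "\<dots> = - (b\<^sup>2 * (a + 2)) / (a + 1)\<^sup>2"
      using a by (simp add: power_divide divide_simps) (simp add: power2_eq_square algebra_simps)
    finally have "b\<^sup>2 * (a + 2) / (a + 1)\<^sup>2 \<le> 0" by simp
    moreover have "0 < (a + 1)\<^sup>2" "0 < a + 2" using a by auto
    ultimately have "b\<^sup>2 \<le> 0" by (simp add: divide_le_0_iff mult_le_0_iff)
    then have "b = 0" by simp
    then show ?thesis by (simp add: b_def)
  qed
  with gH show thesis by (rule that)
qed

end

locale smooth_rkhs = smooth_even_kernel K g Hs C + rkhs H ip "translation_kernel K"
  for K :: "'a::euclidean_space \<Rightarrow> real" and g Hs C H ip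
begin

lemma C_nonneg: "0 \<le> C"
  using kernel_bound[of 0] by simp

lemma kernel_section_mem: "(\<lambda>\<eta>. K (\<eta> - \<xi>)) \<in> H"
  using kernel_mem[of \<xi>] by (simp add: translation_kernel_def)

lemma ip_kernel: "f \<in> H \<Longrightarrow> ip f (\<lambda>\<eta>. K (\<eta> - \<xi>)) = f \<xi>"
  using reproducing[of f \<xi>] by (simp add: translation_kernel_def)

text \<open>Cauchy-Schwarz against the kernel section, whose squared norm is
  \<open>K 0 \<le> C\<close>.\<close>

lemma eval_bound:
  assumes f: "f \<in> H"
  shows "\<bar>f \<eta>\<bar> \<le> rkhs_norm ip f * sqrt C"
proof -
  have "rkhs_norm ip (\<lambda>\<xi>. K (\<xi> - \<eta>)) \<le> sqrt C"
    unfolding rkhs_norm_def ip_kernel[OF kernel_section_mem] using kernel_bound[of 0] by simp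
  then have "rkhs_norm ip f * rkhs_norm ip (\<lambda>\<xi>. K (\<xi> - \<eta>)) \<le> rkhs_norm ip f * sqrt C"
    by (intro mult_left_mono norm_nonneg f)
  with Cauchy_Schwarz[OF f kernel_section_mem, of \<eta>] show ?thesis
    unfolding ip_kernel[OF f] by linarith
qed

text \<open>Second-order Taylor expansion along the segment from 0 to \<open>x\<close>, whose linear
  term vanishes by \<open>grad_zero\<close>. The left side is the squared RKHS distance of kernel
  sections at points that differ by \<open>x\<close>.\<close>

lemma kernel_quadratic: "2 * K 0 - 2 * K x \<le> C * (norm x)\<^sup>2"
proof -
  define D where "D = (\<lambda>m::nat. if m = 0 then (\<lambda>\<tau>. K (\<tau> *\<^sub>R x)) else
    if m = 1 then (\<lambda>\<tau>. g (\<tau> *\<^sub>R x) \<bullet> x) else (\<lambda>\<tau>. Hs (\<tau> *\<^sub>R x) x \<bullet> x))"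
  have "\<exists>t>0. t < 1 \<and> K (1 *\<^sub>R x) = (\<Sum>m<2. D m 0 / fact m * 1 ^ m) + D 2 t / fact 2 * 1 ^ 2"
  proof (rule Maclaurin[where f = "\<lambda>\<tau>. K (\<tau> *\<^sub>R x)"])
    show "\<forall>m t. m < 2 \<and> 0 \<le> t \<and> t \<le> 1 \<longrightarrow> (D m has_real_derivative D (Suc m) t) (at t)"
      using has_gradD[OF grad, of 0 x] hess[of 0 x x] by (auto simp: D_def less_2_cases_iff)
  qed (auto simp: D_def)
  then obtain t where t: "K x = K 0 + g 0 \<bullet> x + Hs (t *\<^sub>R x) x \<bullet> x / 2"
    by (auto simp: D_def lessThan_nat_numeral numeral_2_eq_2)
  have "\<bar>Hs (t *\<^sub>R x) x \<bullet> x\<bar> \<le> norm (Hs (t *\<^sub>R x) x) * norm x" by (rule Cauchy_Schwarz_ineq2)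
  also have "\<dots> \<le> C * norm x * norm x" by (intro mult_right_mono hess_bound) auto
  finally show ?thesis using t by (simp add: grad_zero power2_eq_square)
qed

text \<open>The increment is the inner product of \<open>f\<close> with a difference of kernel
  sections, and \<open>kernel_quadratic\<close> controls the norm of that difference.\<close>

lemma Lipschitz:
  assumes f: "f \<in> H"
  shows "\<bar>f x - f y\<bar> \<le> rkhs_norm ip f * sqrt C * norm (x - y)"
proof -
  let ?d = "\<lambda>\<eta>. K (\<eta> - x) - K (\<eta> - y)"
  have "ip ?d ?d = 2 * K 0 - 2 * K (x - y)"
    using even[of "x - y"]
    by (simp add: ip_diff ip_diff_right kernel_section_mem diff_mem ip_kernel)
  also have "\<dots> \<le> C * (norm (x - y))\<^sup>2" by (rule kernel_quadratic)
  finally have "sqrt (ip ?d ?d) \<le> sqrt (C * (norm (x - y))\<^sup>2)" by (rule real_sqrt_le_mono)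
  then have "rkhs_norm ip ?d \<le> sqrt C * norm (x - y)"
    unfolding rkhs_norm_def by (simp add: real_sqrt_mult)
  then have le: "rkhs_norm ip f * rkhs_norm ip ?d \<le> rkhs_norm ip f * (sqrt C * norm (x - y))"
    by (intro mult_left_mono norm_nonneg f)
  have "f x - f y = ip f ?d"
    by (simp add: ip_diff_right kernel_section_mem f ip_kernel)
  then have "\<bar>f x - f y\<bar> \<le> rkhs_norm ip f * rkhs_norm ip ?d"
    using Cauchy_Schwarz[OF f diff_mem[OF kernel_section_mem kernel_section_mem]] by (simp only:)
  with le show ?thesis by (simp only: mult.assoc)
qed

lemma mem_measurable:
  assumes f: "f \<in> H"
  shows "f \<in> borel_measurable borel"
proof -
  have "(rkhs_norm ip f * sqrt C)-lipschitz_on UNIV f"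
    unfolding lipschitz_on_def dist_norm real_norm_def
    using Lipschitz[OF f] norm_nonneg[OF f] C_nonneg by simp
  then show ?thesis
    by (intro borel_measurable_continuous_onI lipschitz_on_continuous_on)
qed

text \<open>The Lipschitz constant bounds all difference quotients; testing in the direction of the
  gradient itself bounds its norm.\<close>

lemma grad_norm_bound:
  assumes f: "f \<in> H" and Df: "has_grad f Df"
  shows "norm (Df x) \<le> rkhs_norm ip f * sqrt C"
proof -
  let ?B = "rkhs_norm ip f * sqrt C" and ?v = "Df x"
  have "((\<lambda>h. (f (x + h *\<^sub>R ?v) - f x) / h) \<longlongrightarrow> ?v \<bullet> ?v) (at 0)"
    using Df unfolding has_grad_def DERIV_def by fastforce
  then have "?v \<bullet> ?v \<le> ?B * norm ?v"
  proof (rule tendsto_upperbound)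
    show "\<forall>\<^sub>F h in at 0. (f (x + h *\<^sub>R ?v) - f x) / h \<le> ?B * norm ?v"
      unfolding eventually_at_filter
    proof (intro always_eventually allI impI)
      fix h :: real assume h: "h \<noteq> 0"
      have "\<bar>(f (x + h *\<^sub>R ?v) - f x) / h\<bar> \<le> ?B * norm ?v"
        using Lipschitz[OF f, of "x + h *\<^sub>R ?v" x] h by (simp add: divide_le_eq mult_ac)
      then show "(f (x + h *\<^sub>R ?v) - f x) / h \<le> ?B * norm ?v" by linarith
    qed
  qed simp
  then have "norm ?v * norm ?v \<le> ?B * norm ?v" by (simp add: dot_square_norm power2_eq_square)
  then show ?thesis
    using norm_nonneg[OF f] C_nonneg by (cases "norm ?v = 0") (auto simp: mult_le_cancel_right)
qed

text \<open>
  \<open>h \<xi>\<close> is the value of the functional at the kernel section of \<open>\<xi>\<close>, hence \<open>h\<close> is its Riesz representer.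
  Differentiating under the integral makes \<open>h\<close> itself an admissible \<open>f\<close>.
\<close>

lemma first_order_functional_representer:
  fixes a :: "'a \<Rightarrow> real" and w :: "'a \<Rightarrow> 'a"
  assumes sets_m: "sets m = sets borel" and sf: "sigma_finite_measure m"
    and a: "integrable m a" and w: "integrable m w"
  defines "h \<equiv> \<lambda>\<xi>. LINT \<eta>|m. a \<eta> * K (\<eta> - \<xi>) + g (\<eta> - \<xi>) \<bullet> w \<eta>"
  shows "h \<in> H"
    and "has_grad h (\<lambda>\<xi>. LINT \<eta>|m. - (a \<eta> *\<^sub>R g (\<eta> - \<xi>)) - Hs (\<eta> - \<xi>) (w \<eta>))"
    and "\<And>f Df. \<lbrakk>f \<in> H; has_grad f Df\<rbrakk> \<Longrightarrow> ip h f = (LINT \<eta>|m. a \<eta> * f \<eta> + Df \<eta> \<bullet> w \<eta>)"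
proof -
  interpret m: sigma_finite_measure m by fact
  note [measurable_cong] = sets_m
  have [measurable]: "a \<in> borel_measurable borel" "w \<in> borel_measurable borel"
    using borel_measurable_integrable[OF a] borel_measurable_integrable[OF w] sets_m
    by (auto cong: measurable_cong_sets)
  \<comment> \<open>\<open>L\<close> has to be a function of \<open>f\<close> alone, so a gradient
    is selected; by uniqueness the selection agrees with any known gradient.\<close>
  define D where "D = (\<lambda>f::'a \<Rightarrow> real. SOME Df. has_grad f Df)"
  have D_eq: "D f = Df" if "has_grad f Df" for f Df
    unfolding D_def using that has_grad_unique[of f] by blast
  define V where "V = {f \<in> H. \<exists>Df. has_grad f Df}"
  define L where "L f = (LINT \<eta>|m. a \<eta> * f \<eta> + D f \<eta> \<bullet> w \<eta>)" for f
  have VD: "f \<in> H" "has_grad f (D f)" if "f \<in> V" for f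
    using that D_eq unfolding V_def by auto
  have bound: "norm (a \<eta> * f \<eta> + Df \<eta> \<bullet> w \<eta>) \<le> (\<bar>a \<eta>\<bar> + norm (w \<eta>)) * (rkhs_norm ip f * sqrt C)"
    if f: "f \<in> H" and Df: "has_grad f Df" for f Df \<eta>
  proof -
    have "\<bar>a \<eta> * f \<eta>\<bar> \<le> \<bar>a \<eta>\<bar> * (rkhs_norm ip f * sqrt C)"
      using eval_bound[OF f, of \<eta>] by (simp add: abs_mult mult_left_mono)
    moreover have "\<bar>Df \<eta> \<bullet> w \<eta>\<bar> \<le> (rkhs_norm ip f * sqrt C) * norm (w \<eta>)"
      by (rule order_trans[OF Cauchy_Schwarz_ineq2 mult_right_mono[OF grad_norm_bound[OF f Df] norm_ge_zero]])
    ultimately show ?thesis by (simp add: algebra_simps)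
  qed
  have aw: "integrable m (\<lambda>\<eta>. (\<bar>a \<eta>\<bar> + norm (w \<eta>)) * c)" for c
    using a w by auto
  have int: "integrable m (\<lambda>\<eta>. a \<eta> * f \<eta> + Df \<eta> \<bullet> w \<eta>)"
    if f: "f \<in> H" and Df: "has_grad f Df" for f Df
  proof (rule Bochner_Integration.integrable_bound[OF aw])
    have [measurable]: "f \<in> borel_measurable borel" "Df \<in> borel_measurable borel"
      using mem_measurable[OF f] has_grad_measurable[OF Df] by auto
    show "(\<lambda>\<eta>. a \<eta> * f \<eta> + Df \<eta> \<bullet> w \<eta>) \<in> borel_measurable m" by measurable
    show "AE \<eta> in m. norm (a \<eta> * f \<eta> + Df \<eta> \<bullet> w \<eta>)
        \<le> norm ((\<bar>a \<eta>\<bar> + norm (w \<eta>)) * (rkhs_norm ip f * sqrt C))"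
      by (intro AE_I2 order_trans[OF bound[OF f Df]]) simp
  qed
  obtain r where rH: "r \<in> H" and r: "\<And>f. f \<in> V \<Longrightarrow> ip r f = L f"
  proof (rule Riesz_on_subspace[of V L "LINT \<eta>|m. (\<bar>a \<eta>\<bar> + norm (w \<eta>)) * sqrt C"])
    show "(\<lambda>\<xi>. 0) \<in> V"
      unfolding V_def using zero_mem by (auto simp: has_grad_def intro!: exI[of _ "\<lambda>_. 0"])
    fix f assume f: "f \<in> V"
    show "(\<lambda>\<xi>. c * f \<xi>) \<in> V" for c
      using VD[OF f] scale_mem has_grad_scale unfolding V_def by blast
    show "L (\<lambda>\<xi>. c * f \<xi>) = c * L f" for c
      unfolding L_def D_eq[OF has_grad_scale[OF VD(2)[OF f]]]
      by (subst integral_mult_right_zero[symmetric]) (simp add: algebra_simps)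
    have "\<bar>L f\<bar> \<le> (LINT \<eta>|m. (\<bar>a \<eta>\<bar> + norm (w \<eta>)) * (rkhs_norm ip f * sqrt C))"
      using Bochner_Integration.integral_norm_bound_integral[OF int[OF VD[OF f]] aw bound[OF VD[OF f]]]
      unfolding L_def by simp
    also have "\<dots> = (LINT \<eta>|m. (\<bar>a \<eta>\<bar> + norm (w \<eta>)) * sqrt C) * rkhs_norm ip f"
      by simp
    finally show "\<bar>L f\<bar> \<le> (LINT \<eta>|m. (\<bar>a \<eta>\<bar> + norm (w \<eta>)) * sqrt C) * rkhs_norm ip f" .
    fix f' assume f': "f' \<in> V"
    show "(\<lambda>\<xi>. f \<xi> + f' \<xi>) \<in> V"
      using VD[OF f] VD[OF f'] add_mem has_grad_add unfolding V_def by blast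
    show "L (\<lambda>\<xi>. f \<xi> + f' \<xi>) = L f + L f'"
      unfolding L_def D_eq[OF has_grad_add[OF VD(2)[OF f] VD(2)[OF f']]]
      by (subst Bochner_Integration.integral_add[OF int[OF VD[OF f]] int[OF VD[OF f']], symmetric])
         (simp add: algebra_simps)
  qed (auto simp: V_def)
  have grad_section: "has_grad (\<lambda>\<eta>. K (\<eta> - \<xi>)) (\<lambda>\<eta>. g (\<eta> - \<xi>))" for \<xi>
    by (rule has_grad_shift[OF grad])
  \<comment> \<open>Kernel sections belong to \<open>V\<close>, and pairing \<open>r\<close> with
    one of them evaluates \<open>r\<close>; so the abstract representer is known pointwise.\<close>
  have "r \<xi> = h \<xi>" for \<xi>
  proof -
    have "(\<lambda>\<eta>. K (\<eta> - \<xi>)) \<in> V" unfolding V_def using kernel_section_mem grad_section by blast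
    from r[OF this] show ?thesis
      unfolding ip_kernel[OF rH] L_def D_eq[OF grad_section] h_def .
  qed
  then have rh: "r = h" by blast
  show hH: "h \<in> H" using rH rh by simp
  show "ip h f = (LINT \<eta>|m. a \<eta> * f \<eta> + Df \<eta> \<bullet> w \<eta>)" if "f \<in> H" "has_grad f Df" for f Df
    using r[of f] that D_eq[OF that(2)] rh unfolding V_def L_def by auto
  \<comment> \<open>The gradient in \<open>\<xi>\<close> of the integrand of \<open>h\<close>. Both
    terms are negative because \<open>\<xi>\<close> enters through
    \<open>\<eta> - \<xi>\<close>.\<close>
  let ?G = "\<lambda>\<xi> \<eta>. - (a \<eta> *\<^sub>R g (\<eta> - \<xi>)) - Hs (\<eta> - \<xi>) (w \<eta>)"
  have G_bound: "norm (?G \<xi> \<eta>) \<le> (\<bar>a \<eta>\<bar> + norm (w \<eta>)) * C" for \<xi> \<eta>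
  proof -
    have "norm (?G \<xi> \<eta>) \<le> norm (a \<eta> *\<^sub>R g (\<eta> - \<xi>)) + norm (Hs (\<eta> - \<xi>) (w \<eta>))"
      using norm_triangle_ineq4[of "- (a \<eta> *\<^sub>R g (\<eta> - \<xi>))"] by simp
    also have "\<dots> \<le> \<bar>a \<eta>\<bar> * C + C * norm (w \<eta>)"
      using grad_bound by (intro add_mono hess_bound) (simp add: mult_left_mono)
    finally show ?thesis by (simp add: algebra_simps)
  qed
  have G_int: "integrable m (?G \<xi>)" for \<xi>
    by (rule Bochner_Integration.integrable_bound[OF aw[of C]])
       (measurable, use G_bound in \<open>intro AE_I2 order_trans[OF G_bound]\<close>, simp)
  show "has_grad h (\<lambda>\<xi>. LINT \<eta>|m. ?G \<xi> \<eta>)"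
    unfolding has_grad_def
  proof (intro conjI allI)
    show "(\<lambda>\<xi>. LINT \<eta>|m. ?G \<xi> \<eta>) \<in> borel_measurable borel"
      by (rule m.borel_measurable_lebesgue_integral) measurable
    fix \<xi> v
    have "((\<lambda>\<tau>. LINT \<eta>|m. a \<eta> * K (\<eta> - (\<xi> + \<tau> *\<^sub>R v)) + g (\<eta> - (\<xi> + \<tau> *\<^sub>R v)) \<bullet> w \<eta>)
        has_real_derivative (LINT \<eta>|m. ?G (\<xi> + 0 *\<^sub>R v) \<eta> \<bullet> v)) (at 0)"
    proof (rule has_real_derivative_integral[where G = "\<lambda>\<eta>. (\<bar>a \<eta>\<bar> + norm (w \<eta>)) * C * norm v"])
      show "integrable m (\<lambda>\<eta>. a \<eta> * K (\<eta> - (\<xi> + \<tau> *\<^sub>R v)) + g (\<eta> - (\<xi> + \<tau> *\<^sub>R v)) \<bullet> w \<eta>)" for \<tau>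
        by (rule int[OF kernel_section_mem grad_section])
      show "integrable m (\<lambda>\<eta>. (\<bar>a \<eta>\<bar> + norm (w \<eta>)) * C * norm v)"
        by (intro integrable_mult_left aw)
      show "\<bar>?G (\<xi> + \<tau> *\<^sub>R v) \<eta> \<bullet> v\<bar> \<le> (\<bar>a \<eta>\<bar> + norm (w \<eta>)) * C * norm v" for \<tau> \<eta>
        by (rule order_trans[OF Cauchy_Schwarz_ineq2 mult_right_mono[OF G_bound norm_ge_zero]])
      fix \<tau> \<eta>
      have line: "\<eta> - (\<xi> + \<tau> *\<^sub>R v) = (\<eta> - \<xi>) + \<tau> *\<^sub>R (- v)" for \<tau> by simp
      show "((\<lambda>\<tau>. a \<eta> * K (\<eta> - (\<xi> + \<tau> *\<^sub>R v)) + g (\<eta> - (\<xi> + \<tau> *\<^sub>R v)) \<bullet> w \<eta>)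
          has_real_derivative ?G (\<xi> + \<tau> *\<^sub>R v) \<eta> \<bullet> v) (at \<tau>)"
        unfolding line
        by (rule DERIV_cong[OF DERIV_add[OF DERIV_cmult[OF has_gradD[OF grad]] hess]])
           (simp add: inner_diff_left inner_minus_right)
    qed
    then show "((\<lambda>\<tau>. h (\<xi> + \<tau> *\<^sub>R v)) has_real_derivative (LINT \<eta>|m. ?G \<xi> \<eta>) \<bullet> v) (at 0)"
      unfolding h_def by (simp only: integral_inner_left[OF G_int] scaleR_zero_left add_0_right)
  qed
qed

end

text \<open>The operator is the directional derivative along \<open>(1, u z)\<close>: its time and
  space parts are the derivatives along \<open>(1, 0)\<close> and \<open>(0, axis i 1)\<close>. The
  coefficient enters only through its value at \<open>z\<close>.\<close>

lemma transport_op_has_grad: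
  fixes \<phi> :: "real \<times> (real ^ 'n) \<Rightarrow> real"
  assumes "has_grad \<phi> D"
  shows "transport_op u \<phi> z = D z \<bullet> (1, u z)"
proof -
  have line: "((\<lambda>\<tau>. \<phi> (z + \<tau> *\<^sub>R v)) has_real_derivative D z \<bullet> v) (at 0)" for v
    using assms unfolding has_grad_def by blast
  have "((\<lambda>\<tau>. \<phi> (\<tau> + fst z, snd z)) has_real_derivative D z \<bullet> (1, 0)) (at 0)"
    using line[of "(1, 0)"] by (simp add: plus_prod_def add.commute)
  then have "((\<lambda>\<tau>. \<phi> (\<tau>, snd z)) has_real_derivative D z \<bullet> (1, 0)) (at (0 + fst z))"
    by (subst DERIV_shift)
  then have time: "time_deriv \<phi> z = D z \<bullet> (1, 0)"
    unfolding time_deriv_def by (simp add: DERIV_imp_deriv)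
  have "((\<lambda>h. \<phi> (fst z, snd z + h *\<^sub>R axis i 1)) has_real_derivative D z \<bullet> (0, axis i 1)) (at 0)" for i
    using line[of "(0, axis i 1)"] by (simp add: plus_prod_def)
  then have "space_grad \<phi> z $ i = snd (D z) $ i" for i
    unfolding space_grad_def by (simp add: DERIV_imp_deriv inner_prod_def inner_axis)
  then have "space_grad \<phi> z = snd (D z)" by (simp add: vec_eq_iff)
  with time show ?thesis
    by (simp add: transport_op_def inner_prod_def inner_commute)
qed

text \<open>The minus sign of the mixed derivative is the chain rule for
  \<open>\<eta> - \<xi>\<close> in \<open>\<xi>\<close>. The inner coefficient
  \<open>u \<eta>\<close> is constant when the outer operator acts.\<close>

lemma
  fixes K :: "real \<times> (real ^ 'n) \<Rightarrow> real"
  assumes "smooth_even_kernel K g Hs C"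
  shows transport_snd_kernel:
      "transport_snd u (translation_kernel K) \<xi> \<eta> = g (\<eta> - \<xi>) \<bullet> (1, u \<eta>)"
    and transport_fst_snd_kernel:
      "transport_fst u (transport_snd u (translation_kernel K)) \<xi> \<eta> = - Hs (\<eta> - \<xi>) (1, u \<eta>) \<bullet> (1, u \<xi>)"
proof -
  interpret smooth_even_kernel K g Hs C by fact
  show snd: "transport_snd u (translation_kernel K) \<xi> \<eta> = g (\<eta> - \<xi>) \<bullet> (1, u \<eta>)" for \<xi> \<eta>
    unfolding transport_snd_def translation_kernel_swap
    by (rule transport_op_has_grad[OF has_grad_shift[OF grad]])
  have "has_grad (\<lambda>\<xi>. g (\<eta> - \<xi>) \<bullet> (1, u \<eta>)) (\<lambda>\<xi>. - Hs (\<eta> - \<xi>) (1, u \<eta>))"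
    unfolding has_grad_def
  proof (intro conjI allI)
    fix \<xi> v
    have line: "\<eta> - (\<xi> + \<tau> *\<^sub>R v) = (\<eta> - \<xi>) + \<tau> *\<^sub>R (- v)" for \<tau> by simp
    show "((\<lambda>\<tau>. g (\<eta> - (\<xi> + \<tau> *\<^sub>R v)) \<bullet> (1, u \<eta>)) has_real_derivative - Hs (\<eta> - \<xi>) (1, u \<eta>) \<bullet> v) (at 0)"
      unfolding line by (rule DERIV_cong[OF hess]) (simp only: scaleR_zero_left add_0_right inner_minus_left inner_minus_right)
  qed measurable
  then show "transport_fst u (transport_snd u (translation_kernel K)) \<xi> \<eta> = - Hs (\<eta> - \<xi>) (1, u \<eta>) \<bullet> (1, u \<xi>)"
    unfolding transport_fst_def snd by (rule transport_op_has_grad)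
qed

section \<open>Disintegration of the space-time measure\<close>

text \<open>Kept as a measure on space-time, concentrated at time \<open>s\<close>, so that one
  representer lemma serves slices and slabs.\<close>

definition slice :: "(real \<times> 'b::euclidean_space \<Rightarrow> real) \<Rightarrow> real \<Rightarrow> (real \<times> 'b) measure" where
  "slice \<rho> s = distr (density lborel (\<lambda>x. ennreal (\<rho> (s, x)))) borel (Pair s)"

definition slab :: "(real \<times> 'b::euclidean_space \<Rightarrow> real) \<Rightarrow> real \<Rightarrow> (real \<times> 'b) measure" where
  "slab \<rho> t = density lborel (\<lambda>z. ennreal (indicator ({0..t} \<times> UNIV) z * \<rho> z))"

lemma sets_slice [measurable_cong, simp]: "sets (slice \<rho> s) = sets borel"
  by (simp add: slice_def)

lemma sets_slab [measurable_cong, simp]: "sets (slab \<rho> t) = sets borel"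
  by (simp add: slab_def)

locale time_density =
  fixes \<rho> :: "real \<times> 'b::euclidean_space \<Rightarrow> real" and t :: real
  assumes density_measurable [measurable]: "\<rho> \<in> borel_measurable borel"
    and density_nonneg: "0 \<le> \<rho> z"
    and slice_prob: "s \<in> {0..t} \<Longrightarrow> prob_space (slice \<rho> s)"
begin

lemma Pair_measurable [measurable]: "Pair s \<in> borel_measurable (borel :: 'b measure)"
  by (intro borel_measurable_continuous_onI continuous_intros)

lemma density_section_measurable [measurable]: "(\<lambda>x. \<rho> (s, x)) \<in> borel_measurable borel"
  using measurable_compose[OF Pair_measurable density_measurable] .

lemma strip_measurable [measurable]: "{0..t} \<times> (UNIV :: 'b set) \<in> sets borel"
  by (intro borel_closed closed_Times) auto

lemma slice_sigma_finite: "s \<in> {0..t} \<Longrightarrow> sigma_finite_measure (slice \<rho> s)"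
  using slice_prob prob_space_imp_sigma_finite by blast

lemma slab_sigma_finite: "sigma_finite_measure (slab \<rho> t)"
  unfolding slab_def by (subst sigma_finite_measure.sigma_finite_iff_density_finite[OF sigma_finite_lborel]) auto

lemma integral_slice:
  fixes F :: "real \<times> 'b \<Rightarrow> real"
  assumes [measurable]: "F \<in> borel_measurable borel"
  shows "(LINT z|slice \<rho> s. F z) = (LINT x|lborel. \<rho> (s, x) * F (s, x))"
  unfolding slice_def
  by (subst integral_distr, measurable, subst integral_density) (auto simp: density_nonneg)

lemma integrable_slice_iff:
  fixes F :: "real \<times> 'b \<Rightarrow> real"
  assumes [measurable]: "F \<in> borel_measurable borel"
  shows "integrable (slice \<rho> s) F \<longleftrightarrow> integrable lborel (\<lambda>x. \<rho> (s, x) * F (s, x))"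
  unfolding slice_def
  by (subst integrable_distr_eq, measurable, subst integrable_density) (auto simp: density_nonneg)

lemma slab_integrable_prod:
  fixes F :: "real \<times> 'b \<Rightarrow> real"
  assumes F: "integrable (slab \<rho> t) F"
  shows "integrable (lborel \<Otimes>\<^sub>M lborel) (\<lambda>(s, x). indicator {0..t} s * (\<rho> (s, x) * F (s, x)))"
proof -
  have [measurable]: "F \<in> borel_measurable borel"
    using borel_measurable_integrable[OF F] by (simp cong: measurable_cong_sets)
  have "integrable lborel (\<lambda>z. (indicator ({0..t} \<times> UNIV) z * \<rho> z) *\<^sub>R F z)"
    using F unfolding slab_def by (subst (asm) integrable_density) (auto simp: density_nonneg)
  then have "integrable (lborel \<Otimes>\<^sub>M lborel) (\<lambda>z. (indicator ({0..t} \<times> UNIV) z * \<rho> z) *\<^sub>R F z)"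
    by (simp only: lborel_prod)
  then show ?thesis
    by (rule Bochner_Integration.integrable_cong[THEN iffD1, rotated 2]) (auto simp: indicator_def)
qed

lemma slab_disintegration:
  fixes F :: "real \<times> 'b \<Rightarrow> real"
  assumes F: "integrable (slab \<rho> t) F"
  shows "(LINT s:{0..t}|lborel. LINT z|slice \<rho> s. F z) = (LINT z|slab \<rho> t. F z)"
proof -
  have [measurable]: "F \<in> borel_measurable borel"
    using borel_measurable_integrable[OF F] by (simp cong: measurable_cong_sets)
  have "(LINT z|slab \<rho> t. F z) = (LINT z|lborel. (indicator ({0..t} \<times> UNIV) z * \<rho> z) *\<^sub>R F z)"
    unfolding slab_def by (rule integral_density) (auto simp: density_nonneg)
  also have "\<dots> = (LINT (s, x)|(lborel \<Otimes>\<^sub>M lborel). indicator {0..t} s * (\<rho> (s, x) * F (s, x)))"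
    unfolding lborel_prod[symmetric] by (rule Bochner_Integration.integral_cong) (auto simp: indicator_def)
  also have "\<dots> = (LINT s|lborel. LINT x|lborel. indicator {0..t} s * (\<rho> (s, x) * F (s, x)))"
    by (rule lborel_pair.integral_fst[OF slab_integrable_prod[OF F], symmetric])
  finally show ?thesis
    unfolding set_lebesgue_integral_def by (simp add: integral_slice)
qed

text \<open>Space-time integrability passes only to almost every slice, so the disintegrations below
  compare their integrands almost everywhere in time.\<close>

lemma AE_slice_integrable:
  fixes F :: "real \<times> 'b \<Rightarrow> real"
  assumes F: "integrable (slab \<rho> t) F"
  shows "AE s in lborel. s \<in> {0..t} \<longrightarrow> integrable (slice \<rho> s) F"
proof -
  have [measurable]: "F \<in> borel_measurable borel"
    using borel_measurable_integrable[OF F] by (simp cong: measurable_cong_sets)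
  show ?thesis
    using lborel_pair.AE_integrable_fst[OF slab_integrable_prod[OF F]]
    by eventually_elim (auto simp: integrable_slice_iff)
qed

text \<open>By Tonelli, slices of mass one give the slab the length of the time interval as its
  mass. This makes the constant time component of \<open>(1, u)\<close> integrable.\<close>

lemma slab_finite: "finite_measure (slab \<rho> t)"
proof
  have mass: "(\<integral>\<^sup>+x. ennreal (\<rho> (s, x)) \<partial>lborel) = 1" if "s \<in> {0..t}" for s
    using prob_space.emeasure_space_1[OF slice_prob[OF that]]
    unfolding slice_def by (simp add: emeasure_distr emeasure_density)
  have "emeasure (slab \<rho> t) (space (slab \<rho> t)) = (\<integral>\<^sup>+z. ennreal (indicator ({0..t} \<times> UNIV) z * \<rho> z) \<partial>lborel)"
    unfolding slab_def by (simp add: emeasure_density)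
  also have "\<dots> = (\<integral>\<^sup>+s. \<integral>\<^sup>+x. ennreal (indicator ({0..t} \<times> UNIV) (s, x) * \<rho> (s, x)) \<partial>lborel \<partial>lborel)"
    unfolding lborel_prod[symmetric] by (rule lborel.nn_integral_fst[symmetric]) (simp add: lborel_prod)
  also have "\<dots> = (\<integral>\<^sup>+s. indicator {0..t} s \<partial>lborel)"
    using mass by (intro nn_integral_cong) (auto simp: indicator_def)
  also have "\<dots> < \<infinity>" by (simp add: emeasure_lborel_Icc_eq)
  finally show "emeasure (slab \<rho> t) (space (slab \<rho> t)) \<noteq> \<infinity>" by simp
qed

text \<open>The times move from the measure into the integrand. Only the second factor has to be
  sigma-finite for the push-forward of the product, so \<open>s\<close> stays free and the right
  side is an identity of functions of \<open>s\<close>.\<close>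

lemma integral_slice_pair:
  fixes F :: "(real \<times> 'b) \<times> (real \<times> 'b) \<Rightarrow> real"
  assumes [measurable]: "F \<in> borel_measurable (borel \<Otimes>\<^sub>M borel)" and r: "r \<in> {0..t}"
  shows "(LINT z|(slice \<rho> s \<Otimes>\<^sub>M slice \<rho> r). F z) =
    (LINT z|(lborel \<Otimes>\<^sub>M lborel). \<rho> (s, fst z) * \<rho> (r, snd z) * F ((s, fst z), (r, snd z)))"
proof -
  let ?d = "\<lambda>s. density lborel (\<lambda>x. ennreal (\<rho> (s, x)))"
  have "slice \<rho> s \<Otimes>\<^sub>M slice \<rho> r = distr (?d s \<Otimes>\<^sub>M ?d r) (borel \<Otimes>\<^sub>M borel) (\<lambda>(x, y). ((s, x), (r, y)))"
    unfolding slice_def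
    by (rule pair_measure_distr) (use slice_sigma_finite[OF r] in \<open>auto simp: slice_def\<close>)
  also have "?d s \<Otimes>\<^sub>M ?d r = density (lborel \<Otimes>\<^sub>M lborel) (\<lambda>(x, y). ennreal (\<rho> (s, x)) * ennreal (\<rho> (r, y)))"
    by (rule pair_measure_density)
       (auto simp: sigma_finite_measure.sigma_finite_iff_density_finite[OF sigma_finite_lborel] sigma_finite_lborel)
  also have "\<dots> = density (lborel \<Otimes>\<^sub>M lborel) (\<lambda>z. ennreal (\<rho> (s, fst z) * \<rho> (r, snd z)))"
    by (intro arg_cong[where f = "density (lborel \<Otimes>\<^sub>M lborel)"] ext)
       (simp add: case_prod_beta ennreal_mult density_nonneg)
  finally show ?thesis
    by (simp add: integral_distr integral_density case_prod_beta density_nonneg)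
qed

text \<open>
  Almost everywhere equality in \<open>s\<close> does not determine a Bochner integral unless both sides are
  measurable, hence the density form of the integrals over products of slices.
\<close>

lemma slice_pair_measurable:
  fixes F :: "(real \<times> 'b) \<times> (real \<times> 'b) \<Rightarrow> real"
  assumes [measurable]: "F \<in> borel_measurable (borel \<Otimes>\<^sub>M borel)"
  shows "(\<lambda>p. LINT z|(lborel \<Otimes>\<^sub>M lborel). \<rho> (fst p, fst z) * \<rho> (snd p, snd z) * F ((fst p, fst z), (snd p, snd z)))
    \<in> borel_measurable (borel \<Otimes>\<^sub>M borel)"
proof -
  have sf: "sigma_finite_measure (lborel \<Otimes>\<^sub>M lborel :: ('b \<times> 'b) measure)"
    by (rule sigma_finite_pair_measure) (rule sigma_finite_lborel)+
  have [measurable]: "(\<lambda>x. \<rho> (f x, h x)) \<in> borel_measurable N"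
    if "f \<in> borel_measurable N" "h \<in> borel_measurable N" for N :: "'z measure" and f h
    using measurable_compose[OF borel_measurable_Pair[OF that] density_measurable] by simp
  have [measurable]: "(\<lambda>x. F ((f x, h x), (f' x, h' x))) \<in> borel_measurable N"
    if "f \<in> borel_measurable N" "h \<in> borel_measurable N" "f' \<in> borel_measurable N" "h' \<in> borel_measurable N"
    for N :: "'z measure" and f h f' h'
    using measurable_compose[OF measurable_Pair[OF borel_measurable_Pair[OF that(1,2)] borel_measurable_Pair[OF that(3,4)]] assms]
    by simp
  show ?thesis
    by (rule sigma_finite_measure.borel_measurable_lebesgue_integral[OF sf]) measurable
qed

text \<open>Fubini on the slab times the slice, disintegration of the slab, and Fubini again on
  almost every product of slices. The separated bound \<open>b x * c y\<close> is what survives when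
  the slab is replaced by one of its slices.\<close>

lemma slab_slice_disintegration:
  fixes F :: "(real \<times> 'b) \<times> (real \<times> 'b) \<Rightarrow> real"
  assumes F [measurable]: "F \<in> borel_measurable (borel \<Otimes>\<^sub>M borel)"
    and bound: "\<And>x y. \<bar>F (x, y)\<bar> \<le> b x * c y"
    and b: "integrable (slab \<rho> t) b" and c: "integrable (slice \<rho> r) c" and r: "r \<in> {0..t}"
  shows "integrable (slab \<rho> t \<Otimes>\<^sub>M slice \<rho> r) F"
    and "(LINT s:{0..t}|lborel. LINT z|(slice \<rho> s \<Otimes>\<^sub>M slice \<rho> r). F z) =
      (LINT z|(slab \<rho> t \<Otimes>\<^sub>M slice \<rho> r). F z)"
proof -
  interpret P: sigma_finite_measure "slice \<rho> r" by (rule slice_sigma_finite[OF r])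
  interpret N: sigma_finite_measure "slab \<rho> t" by (rule slab_sigma_finite)
  interpret NP: pair_sigma_finite "slab \<rho> t" "slice \<rho> r" ..
  \<comment> \<open>Stated for a general first factor because it is applied to the slab and to
    almost every slice.\<close>
  have dom: "integrable (M \<Otimes>\<^sub>M slice \<rho> r) F"
    if [measurable_cong]: "sets M = sets borel" and "sigma_finite_measure M" "integrable M b" for M
    by (rule Bochner_Integration.integrable_bound[OF
          integrable_pair_mult[OF that(2) P.sigma_finite_measure_axioms that(3) c]])
       (auto simp: case_prod_beta bound intro!: AE_I2 order_trans[OF bound])
  show int: "integrable (slab \<rho> t \<Otimes>\<^sub>M slice \<rho> r) F"
    by (rule dom[OF sets_slab slab_sigma_finite b])
  have "(LINT z|(slab \<rho> t \<Otimes>\<^sub>M slice \<rho> r). F z) = (LINT x|slab \<rho> t. LINT y|slice \<rho> r. F (x, y))"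
    by (rule NP.integral_fst'[OF int, symmetric])
  also have "\<dots> = (LINT s:{0..t}|lborel. LINT x|slice \<rho> s. LINT y|slice \<rho> r. F (x, y))"
    by (rule slab_disintegration[OF NP.integrable_fst'[OF int], symmetric])
  also have "\<dots> = (LINT s:{0..t}|lborel. LINT z|(slice \<rho> s \<Otimes>\<^sub>M slice \<rho> r). F z)"
    unfolding set_lebesgue_integral_def
  proof (rule integral_cong_AE)
    have "(\<lambda>s. LINT z|(lborel \<Otimes>\<^sub>M lborel). \<rho> (s, fst z) * \<rho> (r, snd z) * F ((s, fst z), (r, snd z)))
        \<in> borel_measurable borel"
      using measurable_compose[OF measurable_Pair[OF measurable_ident_sets[OF refl] measurable_const[of r]] slice_pair_measurable[OF F]]
      by simp
    then show "(\<lambda>s. indicat_real {0..t} s *\<^sub>R (LINT z|(slice \<rho> s \<Otimes>\<^sub>M slice \<rho> r). F z)) \<in> borel_measurable lborel"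
      unfolding integral_slice_pair[OF F r] by measurable
    have [measurable]: "(\<lambda>x. LINT y|slice \<rho> r. F (x, y)) \<in> borel_measurable borel"
      by (rule P.borel_measurable_lebesgue_integral) simp
    show "(\<lambda>s. indicat_real {0..t} s *\<^sub>R (LINT x|slice \<rho> s. LINT y|slice \<rho> r. F (x, y))) \<in> borel_measurable lborel"
      by (subst integral_slice) measurable
    show "AE s in lborel. indicat_real {0..t} s *\<^sub>R (LINT x|slice \<rho> s. LINT y|slice \<rho> r. F (x, y))
        = indicat_real {0..t} s *\<^sub>R (LINT z|(slice \<rho> s \<Otimes>\<^sub>M slice \<rho> r). F z)"
      using AE_slice_integrable[OF b]
    proof eventually_elim
      case (elim s)
      show ?case
      proof (cases "s \<in> {0..t}")
        case True
        interpret S: sigma_finite_measure "slice \<rho> s" by (rule slice_sigma_finite[OF True])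
        interpret SP: pair_sigma_finite "slice \<rho> s" "slice \<rho> r" ..
        show ?thesis
          using SP.integral_fst'[OF dom[OF sets_slice S.sigma_finite_measure_axioms]] elim True by simp
      qed simp
    qed
  qed
  finally show "(LINT s:{0..t}|lborel. LINT z|(slice \<rho> s \<Otimes>\<^sub>M slice \<rho> r). F z) =
      (LINT z|(slab \<rho> t \<Otimes>\<^sub>M slice \<rho> r). F z)" by simp
qed

text \<open>The order of integration is exchanged first, so that the second variable is
  disintegrated outside and \<open>r\<close> becomes the outer time;
  \<open>slab_slice_disintegration\<close> then treats almost every \<open>r\<close>.\<close>

lemma slab_slab_disintegration:
  fixes F :: "(real \<times> 'b) \<times> (real \<times> 'b) \<Rightarrow> real"
  assumes F [measurable]: "F \<in> borel_measurable (borel \<Otimes>\<^sub>M borel)"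
    and bound: "\<And>x y. \<bar>F (x, y)\<bar> \<le> b x * c y"
    and b: "integrable (slab \<rho> t) b" and c: "integrable (slab \<rho> t) c"
  shows "(LINT r:{0..t}|lborel. LINT s:{0..t}|lborel. LINT z|(slice \<rho> s \<Otimes>\<^sub>M slice \<rho> r). F z) =
      (LINT x|slab \<rho> t. LINT y|slab \<rho> t. F (x, y))"
proof -
  interpret N: sigma_finite_measure "slab \<rho> t" by (rule slab_sigma_finite)
  interpret NN: pair_sigma_finite "slab \<rho> t" "slab \<rho> t" ..
  have int: "integrable (slab \<rho> t \<Otimes>\<^sub>M slab \<rho> t) F"
    by (rule Bochner_Integration.integrable_bound[OF
          integrable_pair_mult[OF slab_sigma_finite slab_sigma_finite b c]])
       (auto simp: case_prod_beta bound intro!: AE_I2 order_trans[OF bound])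
  have int': "integrable (slab \<rho> t \<Otimes>\<^sub>M slab \<rho> t) (case_prod (\<lambda>x y. F (x, y)))"
    using int by simp
  have "(LINT x|slab \<rho> t. LINT y|slab \<rho> t. F (x, y)) = (LINT y|slab \<rho> t. LINT x|slab \<rho> t. F (x, y))"
    by (rule NN.Fubini_integral[OF int', symmetric])
  also have "\<dots> = (LINT r:{0..t}|lborel. LINT y|slice \<rho> r. LINT x|slab \<rho> t. F (x, y))"
    by (rule slab_disintegration[OF NN.integrable_snd[OF int'], symmetric])
  also have "\<dots> = (LINT r:{0..t}|lborel. LINT s:{0..t}|lborel. LINT z|(slice \<rho> s \<Otimes>\<^sub>M slice \<rho> r). F z)"
    unfolding set_lebesgue_integral_def
  proof (rule integral_cong_AE)
    let ?I = "\<lambda>s r. LINT z|(lborel \<Otimes>\<^sub>M lborel). \<rho> (s, fst z) * \<rho> (r, snd z) * F ((s, fst z), (r, snd z))"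
    have [measurable]: "(\<lambda>(r, s). ?I s r) \<in> borel_measurable (borel \<Otimes>\<^sub>M borel)"
      using measurable_compose[OF measurable_pair_swap' slice_pair_measurable[OF F]] by (simp add: case_prod_beta)
    \<comment> \<open>The density form of the inner integral holds for \<open>r\<close> in the
      interval; elsewhere the indicator makes both sides vanish.\<close>
    have "(\<lambda>r. indicat_real {0..t} r *\<^sub>R (LINT s|lborel. indicat_real {0..t} s *\<^sub>R (LINT z|(slice \<rho> s \<Otimes>\<^sub>M slice \<rho> r). F z)))
      = (\<lambda>r. indicat_real {0..t} r *\<^sub>R (LINT s|lborel. indicat_real {0..t} s *\<^sub>R ?I s r))"
      by (rule ext) (auto simp: integral_slice_pair[OF F] indicator_def)
    also have "\<dots> \<in> borel_measurable lborel" by measurable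
    finally show "(\<lambda>r. indicat_real {0..t} r *\<^sub>R (LINT s|lborel. indicat_real {0..t} s *\<^sub>R (LINT z|(slice \<rho> s \<Otimes>\<^sub>M slice \<rho> r). F z)))
      \<in> borel_measurable lborel" .
    have [measurable]: "(\<lambda>y. LINT x|slab \<rho> t. F (x, y)) \<in> borel_measurable borel"
      by (rule N.borel_measurable_lebesgue_integral) measurable
    show "(\<lambda>r. indicat_real {0..t} r *\<^sub>R (LINT y|slice \<rho> r. LINT x|slab \<rho> t. F (x, y))) \<in> borel_measurable lborel"
      by (subst integral_slice) measurable
    show "AE r in lborel. indicat_real {0..t} r *\<^sub>R (LINT y|slice \<rho> r. LINT x|slab \<rho> t. F (x, y)) =
        indicat_real {0..t} r *\<^sub>R (LINT s|lborel. indicat_real {0..t} s *\<^sub>R (LINT z|(slice \<rho> s \<Otimes>\<^sub>M slice \<rho> r). F z))"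
      using AE_slice_integrable[OF c]
    proof eventually_elim
      case (elim r)
      show ?case
      proof (cases "r \<in> {0..t}")
        case True
        interpret P: sigma_finite_measure "slice \<rho> r" by (rule slice_sigma_finite[OF True])
        interpret NP: pair_sigma_finite "slab \<rho> t" "slice \<rho> r" ..
        have c': "integrable (slice \<rho> r) c" using elim True by simp
        note dis = slab_slice_disintegration[OF F bound b c' True]
        have "(LINT y|slice \<rho> r. LINT x|slab \<rho> t. F (x, y)) = (LINT z|(slab \<rho> t \<Otimes>\<^sub>M slice \<rho> r). F z)"
          using NP.integral_snd[of "\<lambda>x y. F (x, y)"] dis(1) by simp
        then show ?thesis using dis(2) unfolding set_lebesgue_integral_def by simp
      qed simp
    qed
  qed
  finally show ?thesis by simp
qed

end

text \<open>Evaluation at one time is measurable for the product sigma-algebra, so independence of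
  the two processes passes to these space-time points and their joint law is a product.\<close>

lemma expectation_indep_pair:
  fixes X Y :: "real \<Rightarrow> 'w \<Rightarrow> 'b::euclidean_space" and F :: "(real \<times> 'b) \<times> (real \<times> 'b) \<Rightarrow> real"
  assumes M: "prob_space M"
    and ind: "prob_space.indep_var M
         (Pi\<^sub>M A (\<lambda>_. borel)) (\<lambda>\<omega>. \<lambda>s\<in>A. X s \<omega>) (Pi\<^sub>M A (\<lambda>_. borel)) (\<lambda>\<omega>. \<lambda>s\<in>A. Y s \<omega>)"
    and s: "s \<in> A" and r: "r \<in> A"
    and F: "F \<in> borel_measurable (borel \<Otimes>\<^sub>M borel)"
  shows "(LINT \<omega>|M. F ((s, X s \<omega>), (r, Y r \<omega>))) =
    (LINT z|(distr M borel (\<lambda>\<omega>. (s, X s \<omega>)) \<Otimes>\<^sub>M distr M borel (\<lambda>\<omega>. (r, Y r \<omega>))). F z)"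
proof -
  interpret prob_space M by fact
  have [measurable]: "(\<lambda>f. (q, f q)) \<in> borel_measurable (Pi\<^sub>M A (\<lambda>_. borel :: 'b measure))" if "q \<in> A" for q
    using that by measurable
  have "indep_var borel ((\<lambda>f. (s, f s)) \<circ> (\<lambda>\<omega>. \<lambda>s\<in>A. X s \<omega>)) borel ((\<lambda>f. (r, f r)) \<circ> (\<lambda>\<omega>. \<lambda>s\<in>A. Y s \<omega>))"
    by (rule indep_var_compose[OF ind]) (use s r in measurable)
  then have "indep_var borel (\<lambda>\<omega>. (s, X s \<omega>)) borel (\<lambda>\<omega>. (r, Y r \<omega>))"
    using s r by (simp add: comp_def)
  then have "random_variable borel (\<lambda>\<omega>. (s, X s \<omega>))" "random_variable borel (\<lambda>\<omega>. (r, Y r \<omega>))"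
    and eq: "distr M borel (\<lambda>\<omega>. (s, X s \<omega>)) \<Otimes>\<^sub>M distr M borel (\<lambda>\<omega>. (r, Y r \<omega>)) =
      distr M (borel \<Otimes>\<^sub>M borel) (\<lambda>\<omega>. ((s, X s \<omega>), (r, Y r \<omega>)))"
    unfolding indep_var_distribution_eq by auto
  then show ?thesis
    unfolding eq by (subst integral_distr[OF _ F]) auto
qed

section \<open>The residual\<close>

theorem proposition3:
  fixes T :: real
    and \<mu> :: "real \<Rightarrow> (real ^ 'n) measure"
    and p :: "real \<times> (real ^ 'n) \<Rightarrow> real"
    and K :: "real \<times> (real ^ 'n) \<Rightarrow> real"
    and H :: "(real \<times> (real ^ 'n) \<Rightarrow> real) set"
    and ip :: "(real \<times> (real ^ 'n) \<Rightarrow> real) \<Rightarrow> (real \<times> (real ^ 'n) \<Rightarrow> real) \<Rightarrow> real"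
    and u :: "real \<times> (real ^ 'n) \<Rightarrow> real ^ 'n"
    and M :: "'w measure"
    and X Y :: "real \<Rightarrow> 'w \<Rightarrow> real ^ 'n"
    and t :: real
  defines "k \<equiv> translation_kernel K"
  assumes T_pos: "0 < T"
    and \<mu>_borel: "\<And>s. s \<in> {0..T} \<Longrightarrow> sets (\<mu> s) = sets borel"
    and \<mu>_prob: "\<And>s. s \<in> {0..T} \<Longrightarrow> prob_space (\<mu> s)"
    and \<mu>_continuous: "narrowly_continuous_on {0..T} \<mu>"
    and \<mu>_density: "\<And>s. s \<in> {0..T} \<Longrightarrow> \<mu> s = density lborel (\<lambda>x. ennreal (p (s, x)))"
    and rkhs: "rkhs H ip k"
    and A1_continuous: "continuous_on UNIV K"
    and A1_integrable: "integrable lborel K"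
    and A1_positive_definite: "positive_definite_fun K"
    and A1_universal: "fun_support (fourier_transform K) = UNIV"
    and A2: "integrable lborel (\<lambda>z. complex_of_real (1 + (norm z)\<^sup>2) * fourier_transform K z)"
    and A3_L1_continuous: "L1_continuous_on {0..T} p"
    and A3_measurable: "p \<in> borel_measurable (restrict_space borel ({0..T} \<times> UNIV))"
    and A3_bounded: "\<exists>C. AE z in lborel. z \<in> {0..T} \<times> UNIV \<longrightarrow> \<bar>p z\<bar> \<le> C"
    and A3_nonneg: "\<And>s. s \<in> {0..T} \<Longrightarrow> AE x in lborel. 0 \<le> p (s, x)"
    and A3_total_mass: "\<And>s. s \<in> {0..T} \<Longrightarrow> (LINT x|lborel. p (s, x)) = 1"
    and A3_weak_deriv:
      "\<exists>g. set_integrable lborel ({0<..<T} \<times> UNIV) g \<and>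
           weak_time_deriv_on ({0<..<T} \<times> UNIV) p g"
    and M_prob: "prob_space M"
    and X_measurable: "\<And>s. s \<in> {0..T} \<Longrightarrow> X s \<in> borel_measurable M"
    and Y_measurable: "\<And>s. s \<in> {0..T} \<Longrightarrow> Y s \<in> borel_measurable M"
    and X_continuous: "AE \<omega> in M. continuous_on {0..T} (\<lambda>s. X s \<omega>)"
    and Y_continuous: "AE \<omega> in M. continuous_on {0..T} (\<lambda>s. Y s \<omega>)"
    and X_law: "\<And>s. s \<in> {0..T} \<Longrightarrow> distr M borel (X s) = \<mu> s"
    and Y_law: "\<And>s. s \<in> {0..T} \<Longrightarrow> distr M borel (Y s) = \<mu> s"
    and XY_independent:
      "prob_space.indep_var M
         (Pi\<^sub>M {0..T} (\<lambda>_. borel)) (\<lambda>\<omega>. \<lambda>s\<in>{0..T}. X s \<omega>)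
         (Pi\<^sub>M {0..T} (\<lambda>_. borel)) (\<lambda>\<omega>. \<lambda>s\<in>{0..T}. Y s \<omega>)"
    and u_L1:
      "integrable (density (restrict_space lborel ({0..T} \<times> UNIV)) (\<lambda>z. ennreal (p z))) u"
    and t_range: "t \<in> {0..T}"
  defines "I1 \<equiv> LINT r:{0..t}|lborel. LINT s:{0..t}|lborel. LINT \<omega>|M.
                   transport_fst u (transport_snd u k) (s, X s \<omega>) (r, Y r \<omega>)"
    and "I2 \<equiv> LINT \<omega>|M. k (t, X t \<omega>) (t, Y t \<omega>)"
    and "I3 \<equiv> LINT \<omega>|M. k (0, X 0 \<omega>) (0, Y 0 \<omega>)"
    and "I4 \<equiv> LINT s:{0..t}|lborel. LINT \<omega>|M. transport_snd u k (t, X t \<omega>) (s, Y s \<omega>)"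
    and "I5 \<equiv> LINT \<omega>|M. k (0, X 0 \<omega>) (t, Y t \<omega>)"
    and "I6 \<equiv> LINT s:{0..t}|lborel. LINT \<omega>|M. transport_snd u k (0, X 0 \<omega>) (s, Y s \<omega>)"
  shows "transport_residual K p u t \<in> H \<and>
         (rkhs_norm ip (transport_residual K p u t))\<^sup>2
           = I1 + I2 + I3 - 2 * I4 - 2 * I5 + 2 * I6"
proof -
  let ?S = "{0..T} \<times> (UNIV :: (real ^ 'n) set)"
  interpret M: prob_space M by fact
  interpret R: rkhs H ip "translation_kernel K" using rkhs unfolding k_def .

  \<comment> \<open>Regularity of the kernel\<close>
  have even: "K (- x) = K x" for x
    using A1_positive_definite unfolding positive_definite_fun_def by blast
  \<comment> \<open>Cauchy-Schwarz for the kernel sections at 0 and \<open>x\<close>, both of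
    squared norm \<open>K 0\<close>. Fourier inversion needs this bound before any smoothness is
    available.\<close>
  have K_bound: "\<bar>K x\<bar> \<le> K 0" for x
  proof -
    have ipk: "ip (\<lambda>\<xi>. translation_kernel K \<xi> x) (\<lambda>\<xi>. translation_kernel K \<xi> y) = K (y - x)" for x y
      using R.reproducing[OF R.kernel_mem[of x], of y] by (simp add: translation_kernel_def)
    have "0 \<le> K 0" using R.ip_nonneg[OF R.kernel_mem[of x]] ipk[of x x] by simp
    then show ?thesis
      using R.Cauchy_Schwarz[OF R.kernel_mem[of 0] R.kernel_mem[of x]] by (simp add: ipk rkhs_norm_def)
  qed
  obtain A where A: "integrable lborel A" "integrable lborel (\<lambda>z. (norm z)\<^sup>2 * A z)"
    and KA: "\<And>x. K x = (LINT z|lborel. cos (z \<bullet> x) * A z)"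
    using spectral_representation[OF A1_continuous K_bound A1_integrable even A2] by blast
  obtain g Hs C where smooth: "smooth_even_kernel K g Hs C"
    using cosine_transform_smooth[OF A KA] .
  interpret S: smooth_rkhs K g Hs C H ip
    unfolding smooth_rkhs_def using smooth R.rkhs_axioms by blast

  \<comment> \<open>Cutting off at the strip and at 0 gives a nonnegative Borel density on all of
    space-time; \<open>w\<close> likewise extends the direction \<open>(1, u)\<close> by
    zero.\<close>
  define \<rho> where "\<rho> = (\<lambda>z. max 0 (indicator ?S z *\<^sub>R p z))"
  define w where "w = (\<lambda>z. (indicator ?S z :: real, indicator ?S z *\<^sub>R u z))"
  have S_meas [measurable]: "?S \<in> sets borel"
    by (intro borel_closed closed_Times) auto
  have p_meas: "(\<lambda>z. indicator ?S z *\<^sub>R p z) \<in> borel_measurable borel"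
    using A3_measurable by (subst (asm) borel_measurable_restrict_space_iff) auto
  then have [measurable]: "\<rho> \<in> borel_measurable borel" unfolding \<rho>_def by measurable
  have p_meas': "p \<in> borel_measurable (restrict_space lborel ?S)"
    using p_meas by (subst borel_measurable_restrict_space_iff) auto
  have u_meas': "u \<in> borel_measurable (restrict_space lborel ?S)"
    using borel_measurable_integrable[OF u_L1] by simp
  then have u_meas [measurable]: "(\<lambda>z. indicator ?S z *\<^sub>R u z) \<in> borel_measurable borel"
    by (subst (asm) borel_measurable_restrict_space_iff) auto
  have w_meas [measurable]: "w \<in> borel_measurable borel"
    unfolding w_def by (intro borel_measurable_Pair) measurable
  have w_eq: "w (s, x) = (1, u (s, x))" if "s \<in> {0..T}" for s x
    using that by (simp add: w_def)

  \<comment> \<open>Slice measures as laws of the processes\<close>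
  have slice_X: "slice \<rho> s = distr M borel (\<lambda>\<omega>. (s, X s \<omega>))"
    and slice_Y: "slice \<rho> s = distr M borel (\<lambda>\<omega>. (s, Y s \<omega>))" if s: "s \<in> {0..T}" for s
  proof -
    have P: "Pair s \<in> borel_measurable (borel :: (real ^ 'n) measure)"
      by (intro borel_measurable_continuous_onI continuous_intros)
    \<comment> \<open>\<open>ennreal\<close> already sends negative values of \<open>p\<close> to 0,
      so the two densities agree pointwise on this slice.\<close>
    have "density lborel (\<lambda>x. ennreal (\<rho> (s, x))) = \<mu> s"
      unfolding \<mu>_density[OF s] \<rho>_def using s by (intro arg_cong[where f="density lborel"] ext) (simp add: max_def ennreal_neg)
    then have "slice \<rho> s = distr (\<mu> s) borel (Pair s)" by (simp add: slice_def)
    then show "slice \<rho> s = distr M borel (\<lambda>\<omega>. (s, X s \<omega>))" "slice \<rho> s = distr M borel (\<lambda>\<omega>. (s, Y s \<omega>))"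
      using distr_distr[OF P X_measurable[OF s]] distr_distr[OF P Y_measurable[OF s]]
      unfolding X_law[OF s] Y_law[OF s] comp_def by (simp_all only:)
  qed
  have tT: "s \<in> {0..T}" if "s \<in> {0..t}" for s using that t_range by auto
  interpret D: time_density \<rho> t
  proof (rule time_density.intro)
    show "0 \<le> \<rho> z" for z by (simp add: \<rho>_def)
    fix s assume "s \<in> {0..t}"
    then have s: "s \<in> {0..T}" by (rule tT)
    have "(\<lambda>\<omega>. (s, X s \<omega>)) \<in> borel_measurable M"
      using X_measurable[OF s] by (intro borel_measurable_Pair) auto
    then show "prob_space (slice \<rho> s)" unfolding slice_X[OF s] by (rule M.prob_space_distr)
  qed measurable
  have ends: "t \<in> {0..t}" "0 \<in> {0..t}" using t_range by auto
  interpret N: finite_measure "slab \<rho> t" by (rule D.slab_finite)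

  \<comment> \<open>In the residual \<open>p\<close> is a real factor and does not pass through
    \<open>ennreal\<close>; its nonnegativity almost everywhere identifies it with \<rho>
    here.\<close>
  have slice_p: "(LINT y|lborel. p (s, y) * F (s, y)) = (LINT z|slice \<rho> s. F z)"
    if s: "s \<in> {0..T}" and F [measurable]: "F \<in> borel_measurable borel" for s and F :: "real \<times> (real ^ 'n) \<Rightarrow> real"
  proof -
    have [measurable]: "(\<lambda>y. F (s, y)) \<in> borel_measurable borel"
      using measurable_compose[OF D.Pair_measurable F] .
    have [measurable]: "(\<lambda>y. p (s, y)) \<in> borel_measurable borel"
      using measurable_compose[OF D.Pair_measurable p_meas, of s] s by simp
    show ?thesis
      unfolding D.integral_slice[OF F]
    proof (rule integral_cong_AE)
      show "AE y in lborel. p (s, y) * F (s, y) = \<rho> (s, y) * F (s, y)"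
        using A3_nonneg[OF s] by eventually_elim (use s in \<open>simp add: \<rho>_def\<close>)
    qed measurable
  qed
  have expect: "(LINT \<omega>|M. F ((s, X s \<omega>), (r, Y r \<omega>))) = (LINT z|(slice \<rho> s \<Otimes>\<^sub>M slice \<rho> r). F z)"
    if "s \<in> {0..t}" "r \<in> {0..t}" "F \<in> borel_measurable (borel \<Otimes>\<^sub>M borel)"
    for s r and F :: "(real \<times> (real ^ 'n)) \<times> (real \<times> (real ^ 'n)) \<Rightarrow> real"
    using expectation_indep_pair[OF M_prob XY_independent tT[OF that(1)] tT[OF that(2)] that(3)]
    by (simp add: slice_X[OF tT[OF that(1)]] slice_Y[OF tT[OF that(2)]])

  \<comment> \<open>The norm of \<open>w\<close> is at most 1 plus that of the cut-off
    \<open>u\<close>: the finite mass of the slab covers the first summand, the assumption on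
    \<open>u\<close> the second.\<close>
  have w_int: "integrable (slab \<rho> t) w"
  proof (rule integrableI_bounded)
    have "(\<integral>\<^sup>+z. norm (indicator ?S z *\<^sub>R u z) \<partial>slab \<rho> t)
        = (\<integral>\<^sup>+z. ennreal (indicator ({0..t} \<times> UNIV) z * \<rho> z) * norm (indicator ?S z *\<^sub>R u z) \<partial>lborel)"
      unfolding slab_def by (rule nn_integral_density) measurable
    \<comment> \<open>Only an inequality, since the slab ends at \<open>t\<close> while
      \<open>u\<close> is integrable up to \<open>T\<close>.\<close>
    also have "\<dots> \<le> (\<integral>\<^sup>+z. ennreal (p z) * norm (u z) * indicator ?S z \<partial>lborel)"
    proof (rule nn_integral_mono)
      fix z
      have "ennreal (indicator ({0..t} \<times> UNIV) z * \<rho> z) \<le> ennreal (p z)" if "z \<in> ?S"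
        using that by (auto simp: \<rho>_def indicator_def max_def ennreal_neg)
      then show "ennreal (indicator ({0..t} \<times> UNIV) z * \<rho> z) * norm (indicator ?S z *\<^sub>R u z)
          \<le> ennreal (p z) * norm (u z) * indicator ?S z"
        by (auto simp: indicator_def intro!: mult_right_mono)
    qed
    also have "\<dots> = (\<integral>\<^sup>+z. ennreal (p z) * norm (u z) \<partial>restrict_space lborel ?S)"
      by (rule nn_integral_restrict_space[symmetric]) simp
    also have "\<dots> = (\<integral>\<^sup>+z. norm (u z) \<partial>density (restrict_space lborel ?S) (\<lambda>z. ennreal (p z)))"
      using p_meas' u_meas' by (subst nn_integral_density) auto
    also have "\<dots> < \<infinity>" using u_L1 unfolding integrable_iff_bounded by simp
    finally have u_fin: "(\<integral>\<^sup>+z. norm (indicator ?S z *\<^sub>R u z) \<partial>slab \<rho> t) < \<infinity>" .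
    have "(\<integral>\<^sup>+z. norm (w z) \<partial>slab \<rho> t) \<le> (\<integral>\<^sup>+z. 1 + ennreal (norm (indicator ?S z *\<^sub>R u z)) \<partial>slab \<rho> t)"
    proof (rule nn_integral_mono)
      fix z
      have "norm (w z) \<le> norm (indicator ?S z :: real) + norm (indicator ?S z *\<^sub>R u z)"
        unfolding w_def by (rule norm_Pair_le)
      also have "\<dots> \<le> 1 + norm (indicator ?S z *\<^sub>R u z)" by (simp add: indicator_def)
      finally show "ennreal (norm (w z)) \<le> 1 + ennreal (norm (indicator ?S z *\<^sub>R u z))"
        by (simp add: ennreal_leI flip: ennreal_1 ennreal_plus del: ennreal_1)
    qed
    also have "\<dots> = (\<integral>\<^sup>+z. 1 \<partial>slab \<rho> t) + (\<integral>\<^sup>+z. norm (indicator ?S z *\<^sub>R u z) \<partial>slab \<rho> t)"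
      by (rule nn_integral_add) measurable
    also have "\<dots> < \<infinity>"
      using u_fin N.emeasure_finite[of "space (slab \<rho> t)"] by (simp add: less_top[symmetric])
    finally show "(\<integral>\<^sup>+z. norm (w z) \<partial>slab \<rho> t) < \<infinity>" .
  qed measurable

  \<comment> \<open>Representers and the decomposition of the residual\<close>
  define hA where "hA = (\<lambda>\<xi>. LINT \<eta>|slab \<rho> t. g (\<eta> - \<xi>) \<bullet> w \<eta>)"
  define h where "h = (\<lambda>s \<xi>. LINT \<eta>|slice \<rho> s. K (\<eta> - \<xi>))"
  note rep_slab = S.first_order_functional_representer[OF sets_slab D.slab_sigma_finite integrable_zero w_int]
  have hA_mem: "hA \<in> H" using rep_slab(1) by (simp add: hA_def)
  have hA_grad: "has_grad hA (\<lambda>\<xi>. LINT \<eta>|slab \<rho> t. - Hs (\<eta> - \<xi>) (w \<eta>))"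
    using rep_slab(2) by (simp add: hA_def)
  have hA_ip: "ip hA f = (LINT \<eta>|slab \<rho> t. Df \<eta> \<bullet> w \<eta>)" if "f \<in> H" "has_grad f Df" for f Df
    using rep_slab(3)[OF that] by (simp add: hA_def)
  have slice_finite: "finite_measure (slice \<rho> s)" if "s \<in> {0..t}" for s
    using D.slice_prob[OF that] by (simp add: prob_space.finite_measure)
  note rep_slice = S.first_order_functional_representer[OF sets_slice D.slice_sigma_finite
      finite_measure.integrable_const[OF slice_finite, of _ 1] integrable_zero]
  have Hs0: "Hs x 0 = 0" for x using S.hess_bound[of x 0] by simp
  have h_mem: "h s \<in> H" if "s \<in> {0..t}" for s using rep_slice(1)[OF that that] by (simp add: h_def)
  have h_grad: "\<exists>Dh. has_grad (h s) Dh" if "s \<in> {0..t}" for s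
    using rep_slice(2)[OF that that] by (auto simp: h_def)
  have h_ip: "ip (h s) f = (LINT \<eta>|slice \<rho> s. f \<eta>)" if "s \<in> {0..t}" "f \<in> H" "has_grad f Df" for s f Df
    using rep_slice(3)[OF that(1) that(1) that(2,3)] by (simp add: h_def)

  have residual: "transport_residual K p u t = (\<lambda>\<xi>. (hA \<xi> - h t \<xi>) + h 0 \<xi>)"
  proof
    fix \<xi>
    have F [measurable]: "(\<lambda>\<eta>. g (\<eta> - \<xi>) \<bullet> w \<eta>) \<in> borel_measurable borel" by measurable
    have F_int: "integrable (slab \<rho> t) (\<lambda>\<eta>. g (\<eta> - \<xi>) \<bullet> w \<eta>)"
    proof (rule Bochner_Integration.integrable_bound[of _ "\<lambda>\<eta>. C * norm (w \<eta>)"])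
      show "AE \<eta> in slab \<rho> t. norm (g (\<eta> - \<xi>) \<bullet> w \<eta>) \<le> norm (C * norm (w \<eta>))"
        using order_trans[OF Cauchy_Schwarz_ineq2 mult_right_mono[OF S.grad_bound norm_ge_zero]] S.C_nonneg
        by (intro AE_I2) (simp add: abs_mult)
    qed (use w_int in auto)
    have "(LINT r:{0..t}|lborel. LINT y|lborel. p (r, y) * transport_snd u (translation_kernel K) \<xi> (r, y))
        = (LINT r:{0..t}|lborel. LINT \<eta>|slice \<rho> r. g (\<eta> - \<xi>) \<bullet> w \<eta>)"
    proof (rule set_lebesgue_integral_cong)
      show "\<forall>r. r \<in> {0..t} \<longrightarrow> (LINT y|lborel. p (r, y) * transport_snd u (translation_kernel K) \<xi> (r, y))
          = (LINT \<eta>|slice \<rho> r. g (\<eta> - \<xi>) \<bullet> w \<eta>)"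
      proof (intro allI impI)
        fix r assume "r \<in> {0..t}"
        then have r: "r \<in> {0..T}" by (rule tT)
        show "(LINT y|lborel. p (r, y) * transport_snd u (translation_kernel K) \<xi> (r, y))
          = (LINT \<eta>|slice \<rho> r. g (\<eta> - \<xi>) \<bullet> w \<eta>)"
          unfolding slice_p[OF r F, symmetric] by (simp only: transport_snd_kernel[OF smooth] w_eq[OF r])
      qed
    qed simp
    also have "\<dots> = hA \<xi>" unfolding hA_def by (rule D.slab_disintegration[OF F_int])
    finally have 1: "(LINT r:{0..t}|lborel. LINT y|lborel. p (r, y) * transport_snd u (translation_kernel K) \<xi> (r, y)) = hA \<xi>" .
    have 2: "(LINT y|lborel. p (s, y) * translation_kernel K \<xi> (s, y)) = h s \<xi>" if "s \<in> {0..t}" for s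
      unfolding h_def S.translation_kernel_swap by (rule slice_p[OF tT[OF that]]) measurable
    show "transport_residual K p u t \<xi> = (hA \<xi> - h t \<xi>) + h 0 \<xi>"
      unfolding transport_residual_def 1 2[OF ends(1)] 2[OF ends(2)] ..
  qed

  \<comment> \<open>Inner products of the representers as expectations\<close>
  have ip_hA_hA: "ip hA hA = I1"
  proof -
    \<comment> \<open>\<open>hA\<close> is inserted into its own functional. The first argument of
      \<open>F\<close> is the point where its gradient is taken, the second the integration variable
      inside \<open>hA\<close>; they become the points of \<open>X\<close> and
      \<open>Y\<close>.\<close>
    define F where "F z = - (Hs (snd z - fst z) (w (snd z)) \<bullet> w (fst z))" for z
    have F [measurable]: "F \<in> borel_measurable (borel \<Otimes>\<^sub>M borel)" unfolding F_def by measurable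
    have bound: "\<bar>F (x, y)\<bar> \<le> norm (w x) * (C * norm (w y))" for x y
      using order_trans[OF Cauchy_Schwarz_ineq2 mult_right_mono[OF S.hess_bound norm_ge_zero], of "y - x" "w y" "w x"]
      by (simp add: F_def mult.commute)
    have "ip hA hA = (LINT \<xi>|slab \<rho> t. (LINT \<eta>|slab \<rho> t. - Hs (\<eta> - \<xi>) (w \<eta>)) \<bullet> w \<xi>)"
      by (rule hA_ip[OF hA_mem hA_grad])
    also have "\<dots> = (LINT \<xi>|slab \<rho> t. LINT \<eta>|slab \<rho> t. F (\<xi>, \<eta>))"
    proof (rule Bochner_Integration.integral_cong[OF refl])
      fix \<xi>
      have "integrable (slab \<rho> t) (\<lambda>\<eta>. - Hs (\<eta> - \<xi>) (w \<eta>))"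
      proof (rule Bochner_Integration.integrable_bound[of _ "\<lambda>\<eta>. C * norm (w \<eta>)"])
        show "AE \<eta> in slab \<rho> t. norm (- Hs (\<eta> - \<xi>) (w \<eta>)) \<le> norm (C * norm (w \<eta>))"
          using S.hess_bound S.C_nonneg by (intro AE_I2) (simp add: abs_mult)
      qed (use w_int in auto)
      from integral_inner_left[OF this, of "w \<xi>"]
      show "(LINT \<eta>|slab \<rho> t. - Hs (\<eta> - \<xi>) (w \<eta>)) \<bullet> w \<xi> = (LINT \<eta>|slab \<rho> t. F (\<xi>, \<eta>))"
        by (simp add: F_def)
    qed
    also have "\<dots> = (LINT r:{0..t}|lborel. LINT s:{0..t}|lborel. LINT z|(slice \<rho> s \<Otimes>\<^sub>M slice \<rho> r). F z)"
      by (rule D.slab_slab_disintegration[OF F bound, symmetric]) (use w_int in auto)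
    also have "\<dots> = I1"
      unfolding I1_def k_def
    proof (intro set_lebesgue_integral_cong allI impI)
      fix r s assume r: "r \<in> {0..t}" and s: "s \<in> {0..t}"
      show "(LINT z|(slice \<rho> s \<Otimes>\<^sub>M slice \<rho> r). F z) =
          (LINT \<omega>|M. transport_fst u (transport_snd u (translation_kernel K)) (s, X s \<omega>) (r, Y r \<omega>))"
        unfolding expect[OF s r F, symmetric]
        by (simp only: F_def transport_fst_snd_kernel[OF smooth] w_eq[OF tT[OF s]] w_eq[OF tT[OF r]]
            fst_conv snd_conv inner_minus_left)
    qed simp_all
    finally show ?thesis .
  qed

  have ip_h_h: "ip (h a) (h b) = (LINT \<omega>|M. k (a, X a \<omega>) (b, Y b \<omega>))"
    if a: "a \<in> {0..t}" and b: "b \<in> {0..t}" for a b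
  proof -
    interpret P: pair_prob_space "slice \<rho> a" "slice \<rho> b"
      unfolding pair_prob_space_def pair_sigma_finite_def
      using D.slice_prob D.slice_sigma_finite a b by auto
    have F [measurable]: "(\<lambda>z. K (snd z - fst z)) \<in> borel_measurable (borel \<Otimes>\<^sub>M borel)" by measurable
    have int: "integrable (slice \<rho> a \<Otimes>\<^sub>M slice \<rho> b) (\<lambda>z. K (snd z - fst z))"
      by (rule P.integrable_const_bound[of _ C]) (use S.kernel_bound in auto)
    obtain Dh where "has_grad (h b) Dh" using h_grad[OF b] by blast
    then have "ip (h a) (h b) = (LINT \<xi>|slice \<rho> a. LINT \<eta>|slice \<rho> b. K (\<eta> - \<xi>))"
      using h_ip[OF a h_mem[OF b]] by (simp add: h_def)
    also have "\<dots> = (LINT z|(slice \<rho> a \<Otimes>\<^sub>M slice \<rho> b). K (snd z - fst z))"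
      using P.integral_fst'[OF int] by simp
    also have "\<dots> = (LINT \<omega>|M. k (a, X a \<omega>) (b, Y b \<omega>))"
      unfolding k_def S.translation_kernel_swap expect[OF a b F, symmetric] by simp
    finally show ?thesis .
  qed

  have ip_h_hA: "ip (h a) hA = (LINT s:{0..t}|lborel. LINT \<omega>|M. transport_snd u k (a, X a \<omega>) (s, Y s \<omega>))"
    if a: "a \<in> {0..t}" for a
  proof -
    interpret A: prob_space "slice \<rho> a" by (rule D.slice_prob[OF a])
    interpret N: sigma_finite_measure "slab \<rho> t" by (rule D.slab_sigma_finite)
    interpret NA: pair_sigma_finite "slab \<rho> t" "slice \<rho> a" ..
    \<comment> \<open>\<open>F\<close> has the slab variable first, as the disintegration requires.
      \<open>F'\<close> swaps the arguments, so that \<open>X\<close> sits at the fixed time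
      \<open>a\<close> and \<open>Y\<close> at the running time \<open>s\<close>.\<close>
    define F where "F z = g (fst z - snd z) \<bullet> w (fst z)" for z
    define F' where "F' z = g (snd z - fst z) \<bullet> w (snd z)" for z
    have F [measurable]: "F \<in> borel_measurable (borel \<Otimes>\<^sub>M borel)" unfolding F_def by measurable
    have F' [measurable]: "F' \<in> borel_measurable (borel \<Otimes>\<^sub>M borel)" unfolding F'_def by measurable
    have bound: "\<bar>F (x, y)\<bar> \<le> norm (w x) * C" for x y
      using order_trans[OF Cauchy_Schwarz_ineq2 mult_right_mono[OF S.grad_bound norm_ge_zero], of "x - y" "w x"]
      by (simp add: F_def mult.commute)
    note dis = D.slab_slice_disintegration[OF F bound integrable_norm[OF w_int] A.integrable_const a]
    have "ip (h a) hA = (LINT \<xi>|slice \<rho> a. LINT \<eta>|slab \<rho> t. F (\<eta>, \<xi>))"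
      using h_ip[OF a hA_mem hA_grad] by (simp add: hA_def F_def)
    also have "\<dots> = (LINT z|(slab \<rho> t \<Otimes>\<^sub>M slice \<rho> a). F z)"
      using NA.integral_snd[of "\<lambda>x y. F (x, y)"] dis(1) by simp
    also have "\<dots> = (LINT s:{0..t}|lborel. LINT z|(slice \<rho> s \<Otimes>\<^sub>M slice \<rho> a). F z)"
      by (rule dis(2)[symmetric])
    also have "\<dots> = (LINT s:{0..t}|lborel. LINT \<omega>|M. transport_snd u k (a, X a \<omega>) (s, Y s \<omega>))"
    proof (intro set_lebesgue_integral_cong allI impI)
      fix s assume s: "s \<in> {0..t}"
      interpret SA: pair_sigma_finite "slice \<rho> s" "slice \<rho> a"
        unfolding pair_sigma_finite_def using D.slice_sigma_finite s a by blast
      have "F' = (\<lambda>(x, y). F (y, x))" by (auto simp: F_def F'_def)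
      then have "(LINT z|(slice \<rho> s \<Otimes>\<^sub>M slice \<rho> a). F z) = (LINT z|(slice \<rho> a \<Otimes>\<^sub>M slice \<rho> s). F' z)"
        using SA.integral_product_swap[of F] by simp
      also have "\<dots> = (LINT \<omega>|M. transport_snd u k (a, X a \<omega>) (s, Y s \<omega>))"
        unfolding expect[OF a s F', symmetric] k_def
        by (simp only: F'_def transport_snd_kernel[OF smooth] w_eq[OF tT[OF s]] fst_conv snd_conv)
      finally show "(LINT z|(slice \<rho> s \<Otimes>\<^sub>M slice \<rho> a). F z) = (LINT \<omega>|M. transport_snd u k (a, X a \<omega>) (s, Y s \<omega>))" .
    qed simp
    finally show ?thesis .
  qed

  \<comment> \<open>Expansion of the squared norm\<close>
  have mem: "transport_residual K p u t \<in> H"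
    unfolding residual by (intro R.add_mem R.diff_mem hA_mem h_mem ends)
  have "(rkhs_norm ip (transport_residual K p u t))\<^sup>2 = ip (transport_residual K p u t) (transport_residual K p u t)"
    by (rule R.norm_sq[OF mem])
  \<comment> \<open>The signs are those of the products in \<open>hA - h t + h 0\<close>. Symmetry
    of \<open>ip\<close> puts the slice representer first in the terms with \<open>hA\<close>, the
    order in which \<open>ip_h_hA\<close> assigns \<open>X\<close> and \<open>Y\<close>.\<close>
  also have "\<dots> = ip hA hA + ip (h t) (h t) + ip (h 0) (h 0) - 2 * ip (h t) hA - 2 * ip (h 0) (h t) + 2 * ip (h 0) hA"
    unfolding residual
    using hA_mem h_mem[OF ends(1)] h_mem[OF ends(2)] R.ip_sym[OF hA_mem h_mem[OF ends(1)]]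
      R.ip_sym[OF hA_mem h_mem[OF ends(2)]] R.ip_sym[OF h_mem[OF ends(1)] h_mem[OF ends(2)]]
    by (simp add: R.ip_add R.ip_add_right R.ip_diff R.ip_diff_right R.add_mem R.diff_mem)
  finally show ?thesis
    using mem unfolding ip_hA_hA ip_h_h[OF ends(1) ends(1)] ip_h_h[OF ends(2) ends(2)] ip_h_h[OF ends(2) ends(1)]
      ip_h_hA[OF ends(1)] ip_h_hA[OF ends(2)] I2_def I3_def I4_def I5_def I6_def by simp
qed

end
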